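(* Let $\mathcal{X}$ be a filling family of lines in $\mathbb{P}^{n+1}$ and let $X\subset\mathbb{P}^{n+1}$ be an irreducible, reduced complex hypersurface. Assume that the general line $l\in\mathcal{X}$ is tangent to $X$ at a general point $P$ of $X$ (i.e. as $l$ varies in the family, the tangency points $P$ describe a dense subset of $X$). Then $P$ is a focus on $l$. Moreover, if the contact order of $l$ with $X$ at $P$ is at least $2$, then $P$ is a focus with multiplicity at least $2$ on $l$.
   Context: Everything is over $\mathbb{C}$. A family of lines in $\mathbb{P}^{n+1}$ over an integral base $S\subset\mathbb{G}(1,\mathbb{P}^{n+1})$ is given by $\mathcal{X}=\{(s,x): x\in l_s\}\subset S\times\mathbb{P}^{n+1}$, where $l_s$ is the line corresponding to $s$; let $f:\mathcal{X}\to\mathbb{P}^{n+1}$ be the second projection. The family is called filling if $\dim S=n$ and $f$ is dominant. "General line" means $l_s$ for $s$ in a Zariski dense open subset of $S$. Foci: for a general $s\in S$, the focal locus on $l_s$ is the scheme where the natural map $T_{S,s}\otimes\mathcal{O}_{l_s}\cong\mathcal{O}_{l_s}^{\oplus n}\to\mathcal{N}_{l_s|\mathbb{P}^{n+1}}\cong\mathcal{O}_{l_s}(1)^{\oplus n}$ fails to have maximal rank. Explicitly, if $u_1,\dots,u_n$ are local parameters on $S$ and $l_s=\{a_1(s)\cdot\underline{x}=\dots=a_n(s)\cdot\underline{x}=0\}$ with $\underline{x}=(x_0:\dots:x_{n+1})$, it is defined on $l_s$ by $\det\big((\partial_{u_j}a_i)\cdot\underline{x}\big)_{i,j=1,\dots,n}=0$.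 Its points are called foci on $l_s$, and the multiplicity of a focus is its multiplicity as a root of this equation. Contact order: if $l\not\subset X$ is a line and $P\in l\cap X$ has intersection multiplicity $m$, the contact order of $l$ with $X$ at $P$ is $m-1$; $l$ is tangent to $X$ at $P$ if the contact order is at least $1$. *)

theory Defs
  imports
    "HOL-Analysis.Analysis"
    "HOL-Library.Poly_Mapping"
    "HOL-Library.Extended_Nat"
    "HOL-Computational_Algebra.Polynomial"
begin

definition irreducible_space :: "'a topology \<Rightarrow> bool" where
  "irreducible_space T \<longleftrightarrow> topspace T \<noteq> {} \<and>
     (\<forall>U V. openin T U \<and> openin T V \<and> U \<noteq> {} \<and> V \<noteq> {} \<longrightarrow> U \<inter> V \<noteq> {})"

definition irreducible_closed_in :: "'a topology \<Rightarrow> 'a set \<Rightarrow> bool" where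
  "irreducible_closed_in T Z \<longleftrightarrow> closedin T Z \<and> irreducible_space (subtopology T Z)"

definition krull_dim :: "'a topology \<Rightarrow> enat" where
  "krull_dim T = Sup {enat m | m. \<exists>Z :: nat \<Rightarrow> 'a set.
     (\<forall>i\<le>m. irreducible_closed_in T (Z i)) \<and> (\<forall>i<m. Z i \<subset> Z (Suc i))}"

definition locally_closed_in :: "'a topology \<Rightarrow> 'a set \<Rightarrow> bool" where
  "locally_closed_in T A \<longleftrightarrow> (\<exists>U C. openin T U \<and> closedin T C \<and> A = U \<inter> C)"

definition dense_open_in :: "'a topology \<Rightarrow> 'a set \<Rightarrow> bool" where
  "dense_open_in T U \<longleftrightarrow> openin T U \<and> T closure_of U = topspace T"

type_synonym 'i mpoly = "('i \<Rightarrow>\<^sub>0 nat) \<Rightarrow>\<^sub>0 complex"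

text \<open>Evaluation at a point with coordinates in a \<open>\<complex>\<close>-algebra with structure map \<open>h\<close>.\<close>

definition eval_in ::
    "(complex \<Rightarrow> 'b::comm_semiring_1) \<Rightarrow> ('i::finite) mpoly \<Rightarrow> ('i \<Rightarrow> 'b) \<Rightarrow> 'b" where
  "eval_in h Q x = (\<Sum>m\<in>Poly_Mapping.keys Q.
     h (Poly_Mapping.lookup Q m) * (\<Prod>i\<in>UNIV. x i ^ Poly_Mapping.lookup m i))"

abbreviation eval_at :: "('i::finite) mpoly \<Rightarrow> ('i \<Rightarrow> complex) \<Rightarrow> complex" where
  "eval_at Q x \<equiv> eval_in (\<lambda>c. c) Q x"

text \<open>The polynomial \<open>Q (x + t y)\<close> in \<open>t\<close>.\<close>

definition along :: "('i::finite) mpoly \<Rightarrow> ('i \<Rightarrow> complex) \<Rightarrow> ('i \<Rightarrow> complex) \<Rightarrow> complex poly" where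
  "along Q x y = eval_in (\<lambda>c. [:c:]) Q (\<lambda>i. [:x i, y i:])"

definition homogeneous :: "nat \<Rightarrow> ('i::finite) mpoly \<Rightarrow> bool" where
  "homogeneous d Q \<longleftrightarrow> (\<forall>m\<in>Poly_Mapping.keys Q. (\<Sum>i\<in>UNIV. Poly_Mapping.lookup m i) = d)"

text \<open>
  Throughout, \<open>n\<close> is the number of elements of the type \<open>'n\<close> (so \<open>n \<ge> 1\<close>), and the
  \<open>n + 2\<close> homogeneous coordinates of \<open>\<bbbP>\<^sup>n\<^sup>+\<^sup>1\<close> are indexed by \<open>'n option option\<close>.
  Points and lines of \<open>\<bbbP>\<^sup>n\<^sup>+\<^sup>1\<close> are the linear subspaces of dimension 1 and 2
  of \<open>\<complex>\<^sup>n\<^sup>+\<^sup>2\<close>; a point \<open>P\<close> lies on a line \<open>L\<close> iff \<open>P \<subseteq> L\<close>.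
\<close>

type_synonym 'n hvec = "complex ^ 'n option option"

definition points :: "('n::finite) hvec set set" where
  "points = {P. vec.subspace P \<and> vec.dim P = 1}"

definition lines :: "('n::finite) hvec set set" where
  "lines = {L. vec.subspace L \<and> vec.dim L = 2}"

definition vanishes_at :: "'n option option mpoly \<Rightarrow> ('n::finite) hvec set \<Rightarrow> bool" where
  "vanishes_at F P \<longleftrightarrow> (\<forall>x\<in>P. eval_at F (($) x) = 0)"

definition zero_set :: "'n option option mpoly \<Rightarrow> ('n::finite) hvec set set" where
  "zero_set F = {P \<in> points. vanishes_at F P}"

definition proj_zariski :: "('n::finite) hvec set topology" where
  "proj_zariski = topology_generated_by {points - zero_set F | F. \<exists>d>0. homogeneous d F}"

text \<open>
  A line is given by \<open>n\<close> independent linear equations, the rows of an \<open>n \<times> (n + 2)\<close> matrix.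
  The Grassmannian is the quotient of the space of matrices of rank \<open>n\<close> by the left action
  of \<open>GL\<^sub>n\<close>. The quotient map \<open>line_of\<close> is open, hence the images of the principal open sets
  generate the Zariski topology on the Grassmannian.
\<close>

type_synonym 'n eqs = "complex ^ 'n option option ^ 'n"

definition line_of :: "('n::finite) eqs \<Rightarrow> 'n hvec set" where
  "line_of A = {x. A *v x = 0}"

definition entries :: "('n::finite) eqs \<Rightarrow> 'n \<times> 'n option option \<Rightarrow> complex" where
  "entries A = (\<lambda>(i, k). A $ i $ k)"

definition grass_zariski :: "('n::finite) hvec set topology" where
  "grass_zariski = topology_generated_by
     {{line_of A | A. line_of A \<in> lines \<and> eval_at Q (entries A) \<noteq> 0} | Q. True}"

definition total_space :: "('n::finite) hvec set set \<Rightarrow> ('n hvec set \<times> 'n hvec set) set" where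
  "total_space S = {(L, P). L \<in> S \<and> P \<in> points \<and> P \<subseteq> L}"

text \<open>
  The integral base is an irreducible locally closed subset of the Grassmannian with its
  reduced structure.
\<close>

definition family_of_lines :: "('n::finite) hvec set set \<Rightarrow> bool" where
  "family_of_lines S \<longleftrightarrow> S \<subseteq> lines \<and> locally_closed_in grass_zariski S \<and>
     irreducible_space (subtopology grass_zariski S)"

definition filling_family :: "('n::finite) hvec set set \<Rightarrow> bool" where
  "filling_family S \<longleftrightarrow> family_of_lines S \<and>
     krull_dim (subtopology grass_zariski S) = enat CARD('n) \<and>
     proj_zariski closure_of (snd ` total_space S) = points"

text \<open>
  \<open>frames S\<close> is the principal \<open>GL\<^sub>n\<close>-bundle over \<open>S\<close> of all systems of equations of the
  lines of \<open>S\<close>. Its Zariski tangent space at \<open>A\<close> consists of the \<open>\<complex>[\<epsilon>]\<close>-points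
  \<open>A + \<epsilon> B\<close>. It maps onto the tangent space of \<open>S\<close> at \<open>line_of A\<close>, with kernel
  \<open>{M ** A | M}\<close>: if \<open>a\<close> is a local lift of \<open>S\<close> to systems of equations with
  \<open>a(s) = A\<close> and \<open>u\<^sub>1, \<dots>, u\<^sub>n\<close> are local parameters at a smooth point \<open>s\<close>, then the
  derivatives \<open>\<partial>a/\<partial>u\<^sub>j\<close> at \<open>s\<close> lie in it and form a basis modulo this kernel.
\<close>

definition frames :: "('n::finite) hvec set set \<Rightarrow> 'n eqs set" where
  "frames S = {A. line_of A \<in> S}"

definition frame_tangent :: "('n::finite) hvec set set \<Rightarrow> 'n eqs \<Rightarrow> 'n eqs set" where
  "frame_tangent S A = {B. \<forall>Q. (\<forall>A'\<in>frames S. eval_at Q (entries A') = 0) \<longrightarrow>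
     [:0, 1:] ^ 2 dvd along Q (entries A) (entries B)}"

text \<open>
  At \<open>x \<in> L = line_of A\<close> the map from the tangent space of \<open>S\<close> to the fibre of
  \<open>\<N>\<^bsub>L\<^esub>\<close> sends the class of \<open>B\<close> to \<open>B *v x\<close> (the fibre being identified with
  \<open>\<complex>\<^sup>n\<close> by the equations \<open>A\<close>; the rows of \<open>M ** A\<close> vanish on \<open>L\<close>). The scheme where it
  fails to have rank \<open>n\<close> is defined by its maximal minors, given here in the coordinate
  \<open>t\<close> on \<open>L\<close> for which \<open>x = p + t q\<close>. At a smooth point of \<open>S\<close> they are all multiples of
  the single equation obtained from \<open>B j = \<partial>a/\<partial>u\<^sub>j\<close>.
\<close>

definition focal_minors ::
    "('n::finite) hvec set set \<Rightarrow> 'n hvec set \<Rightarrow> 'n hvec \<Rightarrow> 'n hvec \<Rightarrow> complex poly set" where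
  "focal_minors S L p q =
     {det (\<chi> i j. [:(B j *v p) $ i, (B j *v q) $ i:]) | A (B :: 'n \<Rightarrow> 'n eqs).
        line_of A = L \<and> (\<forall>j. B j \<in> frame_tangent S A)}"

text \<open>\<open>p + t q\<close> is a coordinate on \<open>L\<close> with \<open>t = 0\<close> at \<open>P\<close>.\<close>

definition line_coords :: "('n::finite) hvec set \<Rightarrow> 'n hvec set \<Rightarrow> 'n hvec \<Rightarrow> 'n hvec \<Rightarrow> bool" where
  "line_coords L P p q \<longleftrightarrow> P = vec.span {p} \<and> L = vec.span {p, q}"

definition focus_of_mult_ge ::
    "nat \<Rightarrow> ('n::finite) hvec set set \<Rightarrow> 'n hvec set \<Rightarrow> 'n hvec set \<Rightarrow> bool" where
  "focus_of_mult_ge m S L P \<longleftrightarrow> L \<in> S \<and> P \<in> points \<and> P \<subseteq> L \<and>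
     (\<forall>p q. line_coords L P p q \<longrightarrow> (\<forall>g\<in>focal_minors S L p q. [:0, 1:] ^ m dvd g))"

definition is_focus :: "('n::finite) hvec set set \<Rightarrow> 'n hvec set \<Rightarrow> 'n hvec set \<Rightarrow> bool" where
  "is_focus S L P \<longleftrightarrow> L \<in> S \<and> P \<in> points \<and> P \<subseteq> L \<and>
     (\<forall>p q. line_coords L P p q \<longrightarrow> (\<forall>g\<in>focal_minors S L p q. poly g 0 = 0))"

definition hypersurface :: "('n::finite) hvec set set \<Rightarrow> bool" where
  "hypersurface X \<longleftrightarrow> (\<exists>F d. F \<noteq> 0 \<and> d > 0 \<and> homogeneous d F \<and> X = zero_set F)"

text \<open>The homogeneous elements of the ideal of \<open>X\<close> with its reduced structure.\<close>

definition hom_ideal :: "('n::finite) hvec set set \<Rightarrow> 'n option option mpoly set" where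
  "hom_ideal X = {G. (\<exists>d. homogeneous d G) \<and> (\<forall>P\<in>X. vanishes_at G P)}"

text \<open>
  The length at \<open>P\<close> of the scheme-theoretic intersection of \<open>L\<close> with the reduced \<open>X\<close>, i.e.
  the least order of vanishing at \<open>P\<close> of an element of the ideal of \<open>X\<close> restricted to \<open>L\<close>
  (attained by a generator of the ideal). The order does not depend on the coordinates.
  Meaningful for \<open>L\<close> not contained in \<open>X\<close>.
\<close>

definition intersection_mult ::
    "('n::finite) hvec set set \<Rightarrow> 'n hvec set \<Rightarrow> 'n hvec set \<Rightarrow> nat" where
  "intersection_mult X L P = (LEAST m. \<exists>p q. \<exists>G\<in>hom_ideal X. line_coords L P p q \<and>
     along G (($) p) (($) q) \<noteq> 0 \<and> order 0 (along G (($) p) (($) q)) = m)"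

definition contact_order ::
    "('n::finite) hvec set set \<Rightarrow> 'n hvec set \<Rightarrow> 'n hvec set \<Rightarrow> nat" where
  "contact_order X L P = intersection_mult X L P - 1"

definition tangent_at ::
    "('n::finite) hvec set set \<Rightarrow> 'n hvec set \<Rightarrow> 'n hvec set \<Rightarrow> bool" where
  "tangent_at X L P \<longleftrightarrow> L \<in> lines \<and> \<not> {R \<in> points. R \<subseteq> L} \<subseteq> X \<and>
     P \<in> X \<and> P \<subseteq> L \<and> contact_order X L P \<ge> 1"

end

theory Submission
  imports Defs
begin

text \<open>
  Let \<open>G\<close> be a form of least degree vanishing on \<open>X\<close>, and let \<open>f\<^sub>L\<close> be its restriction to a line
  \<open>L\<close> of the family. Points of contact are multiple roots of \<open>f\<^sub>L\<close>. Over the function field of the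
  base, in characteristic zero, \<open>gcd f f'\<close> divides every derivative of \<open>f\<close> along the base. Hence for
  a general line the derivative of \<open>f\<close> along any tangent vector of the base vanishes at each
  multiple root, and the derivative of \<open>f'\<close> vanishes at each root of multiplicity at least three.
  In other words, the contact point can be moved with the line to first order, staying on \<open>X\<close> with
  its contact condition. So at \<open>P\<close> the focal matrix has its image in the tangent hyperplane
  \<open>T\<^sub>P X\<close> modulo \<open>L\<close>, and its determinant vanishes; with contact order two, the derivative of
  the determinant along the line vanishes as well.
\<close>

section \<open>Families of polynomials over an algebra of functions\<close>

text \<open>A multiple root of \<open>f\<^sub>L\<close> need not be a single-valued function of
  \<open>L\<close>, so the contact point is not differentiated as a root. With \<open>h\<close> the
  greatest common divisor, \<open>c f = h k\<close>, and both factors vanish at a multiple root; by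
  the Leibniz rule the derivative of \<open>f\<close> along the base, at that fixed parameter value
  on the line, is zero. The same applies to \<open>f'\<close>, whose multiple roots include the
  triple roots of \<open>f\<close>. All this takes place on systems of equations: the Grassmannian,
  being projective, has no nonconstant global functions, whereas polynomials in the matrix entries
  suffice to write points of the line, coefficients of \<open>f\<close> and denominators
  \<open>c\<close>. A general line is then one with equations at which some such polynomial is
  nonzero. For multiplicity two only the tangent vectors in the kernel of the focal matrix at
  \<open>P\<close> have to be examined: if \<open>\<phi> M\<^sub>0 = 0\<close> and
  \<open>\<phi> M\<^sub>1\<close> kills the kernel of \<open>M\<^sub>0\<close>, then
  \<open>det (M\<^sub>0 + t M\<^sub>1)\<close> has a double zero at \<open>t = 0\<close>.\<close>

definition subalgebra :: "('x \<Rightarrow> complex) set \<Rightarrow> bool" where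
  "subalgebra R \<longleftrightarrow> (\<forall>c. (\<lambda>x. c) \<in> R) \<and>
     (\<forall>f\<in>R. \<forall>g\<in>R. (\<lambda>x. f x + g x) \<in> R \<and> (\<lambda>x. f x * g x) \<in> R)"

lemma subalgebra_const: "subalgebra R \<Longrightarrow> (\<lambda>x. c) \<in> R"
  and subalgebra_add: "subalgebra R \<Longrightarrow> f \<in> R \<Longrightarrow> g \<in> R \<Longrightarrow> (\<lambda>x. f x + g x) \<in> R"
  and subalgebra_mult: "subalgebra R \<Longrightarrow> f \<in> R \<Longrightarrow> g \<in> R \<Longrightarrow> (\<lambda>x. f x * g x) \<in> R"
  unfolding subalgebra_def by blast+

lemma subalgebra_sum:
  "subalgebra R \<Longrightarrow> (\<And>i. i \<in> I \<Longrightarrow> (\<lambda>x. f i x) \<in> R) \<Longrightarrow> (\<lambda>x. \<Sum>i\<in>I. f i x) \<in> R"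
  by (induction I rule: infinite_finite_induct)
     (simp_all add: subalgebra_const subalgebra_add)

lemma subalgebra_prod:
  "subalgebra R \<Longrightarrow> (\<And>i. i \<in> I \<Longrightarrow> (\<lambda>x. f i x) \<in> R) \<Longrightarrow> (\<lambda>x. \<Prod>i\<in>I. f i x) \<in> R"
  by (induction I rule: infinite_finite_induct)
     (simp_all add: subalgebra_const subalgebra_mult)

lemma subalgebra_power: "subalgebra R \<Longrightarrow> f \<in> R \<Longrightarrow> (\<lambda>x. f x ^ n) \<in> R"
  by (induction n) (simp_all add: subalgebra_const subalgebra_mult)

lemma subalgebra_eval_at:
  assumes "subalgebra R" "\<And>i. (\<lambda>x. g x i) \<in> R"
  shows "(\<lambda>x. eval_at Q (g x)) \<in> R"
  unfolding eval_in_def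
  by (intro subalgebra_sum subalgebra_mult subalgebra_const subalgebra_prod subalgebra_power assms)

lemma subalgebra_det:
  assumes "subalgebra R" "\<And>i j. (\<lambda>x. M x $ i $ j) \<in> R"
  shows "(\<lambda>x. det (M x)) \<in> R"
  unfolding det_def
  by (intro subalgebra_sum subalgebra_mult subalgebra_const subalgebra_prod assms)

text \<open>The uniform degree bound makes this an element of \<open>R[t]\<close>, viewed pointwise.
  Membership of each coefficient alone would admit families of unbounded degree, to which division
  is not applicable.\<close>

definition poly_family :: "('x \<Rightarrow> complex) set \<Rightarrow> ('x \<Rightarrow> complex poly) \<Rightarrow> bool" where
  "poly_family R f \<longleftrightarrow> (\<forall>i. (\<lambda>x. coeff (f x) i) \<in> R) \<and> (\<exists>N. \<forall>x. degree (f x) \<le> N)"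

lemma poly_family_coeff: "poly_family R f \<Longrightarrow> (\<lambda>x. coeff (f x) i) \<in> R"
  by (simp add: poly_family_def)

lemma poly_family_const: "subalgebra R \<Longrightarrow> poly_family R (\<lambda>x. p)"
  by (auto simp: poly_family_def subalgebra_const)

lemma poly_family_monom: "subalgebra R \<Longrightarrow> r \<in> R \<Longrightarrow> poly_family R (\<lambda>x. monom (r x) n)"
proof -
  assume "subalgebra R" "r \<in> R"
  then have "(\<lambda>x. coeff (monom (r x) n) i) \<in> R" for i
    by (cases "n = i") (simp_all add: subalgebra_const)
  then show ?thesis by (auto simp: poly_family_def intro: degree_monom_le)
qed

lemma poly_family_add:
  assumes "subalgebra R" "poly_family R f" "poly_family R g"
  shows "poly_family R (\<lambda>x. f x + g x)"
proof -
  obtain M N where "\<And>x. degree (f x) \<le> M" "\<And>x. degree (g x) \<le> N"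
    using assms(2,3) by (auto simp: poly_family_def)
  then have "degree (f x + g x) \<le> max M N" for x
    by (meson degree_add_le le_max_iff_disj)
  with assms show ?thesis by (auto simp: poly_family_def intro: subalgebra_add)
qed

lemma poly_family_mult:
  assumes "subalgebra R" "poly_family R f" "poly_family R g"
  shows "poly_family R (\<lambda>x. f x * g x)"
proof -
  obtain M N where "\<And>x. degree (f x) \<le> M" "\<And>x. degree (g x) \<le> N"
    using assms(2,3) by (auto simp: poly_family_def)
  then have "degree (f x * g x) \<le> M + N" for x
    by (meson add_mono degree_mult_le order_trans)
  with assms show ?thesis
    by (auto simp: poly_family_def coeff_mult intro!: subalgebra_sum subalgebra_mult)
qed

lemma poly_family_sum:
  "subalgebra R \<Longrightarrow> (\<And>i. i \<in> I \<Longrightarrow> poly_family R (\<lambda>x. f i x)) \<Longrightarrow> poly_family R (\<lambda>x. \<Sum>i\<in>I. f i x)"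
  by (induction I rule: infinite_finite_induct)
     (simp_all add: poly_family_const poly_family_add)

lemma poly_family_prod:
  "subalgebra R \<Longrightarrow> (\<And>i. i \<in> I \<Longrightarrow> poly_family R (\<lambda>x. f i x)) \<Longrightarrow> poly_family R (\<lambda>x. \<Prod>i\<in>I. f i x)"
  by (induction I rule: infinite_finite_induct)
     (simp_all add: poly_family_const poly_family_mult)

lemma poly_family_power: "subalgebra R \<Longrightarrow> poly_family R f \<Longrightarrow> poly_family R (\<lambda>x. f x ^ n)"
  by (induction n) (simp_all add: poly_family_const poly_family_mult)

lemma poly_family_pderiv:
  assumes "subalgebra R" "poly_family R f"
  shows "poly_family R (\<lambda>x. pderiv (f x))"
proof -
  obtain N where "\<And>x. degree (f x) \<le> N"
    using assms(2) by (auto simp: poly_family_def)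
  then have "degree (pderiv (f x)) \<le> N" for x
    by (metis degree_pderiv diff_le_self le_trans)
  with assms show ?thesis
    by (auto simp: poly_family_def coeff_pderiv intro!: subalgebra_mult subalgebra_const
        simp del: of_nat_Suc)
qed

lemma poly_family_pCons:
  assumes "subalgebra R" "r \<in> R" "s \<in> R"
  shows "poly_family R (\<lambda>x. [:r x, s x:])"
proof -
  have "[:r x, s x:] = monom (r x) 0 + monom (s x) 1" for x
    by (simp add: monom_altdef)
  then show ?thesis
    using assms by (simp add: poly_family_add poly_family_monom)
qed

lemma poly_family_along:
  assumes "subalgebra R" "\<And>i. (\<lambda>z. p z i) \<in> R" "\<And>i. (\<lambda>z. q z i) \<in> R"
  shows "poly_family R (\<lambda>z. along Q (p z) (q z))"
  unfolding along_def eval_in_def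
  by (intro poly_family_sum poly_family_mult poly_family_const poly_family_prod poly_family_power
      poly_family_pCons assms)

lemma poly_family_poly:
  assumes "subalgebra R" "poly_family R f"
  shows "(\<lambda>x. poly (f x) a) \<in> R"
proof -
  obtain N where N: "\<And>x. degree (f x) \<le> N"
    using assms(2) by (auto simp: poly_family_def)
  have "poly (f x) a = (\<Sum>i\<le>N. coeff (f x) i * a ^ i)" for x
  proof -
    have "poly (f x) a = poly (\<Sum>i\<le>N. monom (coeff (f x) i) i) a"
      by (simp add: poly_as_sum_of_monoms' N)
    then show ?thesis by (simp add: poly_sum poly_monom)
  qed
  with assms show ?thesis
    by (auto intro!: subalgebra_sum subalgebra_mult subalgebra_const poly_family_coeff)
qed

text \<open>Euclidean division in which every step multiplies by the coefficient of degree
  \<open>e\<close> of \<open>h\<close> instead of dividing by it, as that coefficient need not be a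
  unit of \<open>R\<close>. Degrees are controlled on \<open>Z\<close> only, while the division
  identity holds at every \<open>x\<close>.\<close>

lemma poly_family_pseudo_division:
  assumes R: "subalgebra R" and h: "poly_family R h"
    and deg: "\<And>x i. x \<in> Z \<Longrightarrow> e < i \<Longrightarrow> coeff (h x) i = 0"
    and f: "poly_family R f" "\<And>x i. x \<in> Z \<Longrightarrow> n \<le> i \<Longrightarrow> coeff (f x) i = 0"
  shows "\<exists>N k r. poly_family R k \<and> poly_family R r \<and>
    (\<forall>x. [:coeff (h x) e ^ N:] * f x = h x * k x + r x) \<and>
    (\<forall>x\<in>Z. \<forall>i\<ge>e. coeff (r x) i = 0)"
  using f
proof (induction n arbitrary: f)
  case 0
  then show ?case
    by (intro exI[of _ 0] exI[of _ "\<lambda>x. 0"] exI[of _ f])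
       (auto simp: poly_family_const R)
next
  case (Suc m)
  show ?case
  proof (cases "Suc m \<le> e")
    case True
    with Suc.prems show ?thesis
      by (intro exI[of _ 0] exI[of _ "\<lambda>x. 0"] exI[of _ f])
         (auto simp: poly_family_const R)
  next
    case False
    define g where "g x = monom (coeff (f x) m) (m - e)" for x
    define f1 where "f1 x = monom (coeff (h x) e) 0 * f x + [:-1:] * (g x * h x)" for x
    have g: "poly_family R g"
      unfolding g_def by (intro poly_family_monom poly_family_coeff Suc.prems R)
    have f1: "poly_family R f1"
      unfolding f1_def
      by (intro poly_family_add poly_family_mult poly_family_const poly_family_monom
          poly_family_coeff g h R Suc.prems)
    have "coeff (f1 x) i = 0" if x: "x \<in> Z" and i: "m \<le> i" for x i
    proof -
      have "coeff (f1 x) i = coeff (h x) e * coeff (f x) i - coeff (f x) m * coeff (h x) (i - (m - e))"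
        using i by (auto simp: f1_def g_def coeff_monom_mult monom_0)
      moreover have "i - (m - e) > e" if "i \<noteq> m"
        using that i False by simp
      moreover have "coeff (f x) i = 0" if "i \<noteq> m"
        using that i Suc.prems(2)[OF x] by simp
      ultimately show ?thesis
        using deg[OF x] False by (cases "i = m") auto
    qed
    from Suc.IH[OF f1 this] obtain N k r where IH: "poly_family R k" "poly_family R r"
      "\<And>x. [:coeff (h x) e ^ N:] * f1 x = h x * k x + r x"
      "\<And>x i. x \<in> Z \<Longrightarrow> e \<le> i \<Longrightarrow> coeff (r x) i = 0"
      by metis
    have *: "[:coeff (h x) e ^ Suc N:] * f x =
        h x * (k x + monom (coeff (h x) e ^ N) 0 * g x) + r x" for x
    proof -
      have "[:coeff (h x) e ^ Suc N:] * f x = [:coeff (h x) e ^ N:] * (f1 x + g x * h x)"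
        by (simp add: f1_def monom_0 algebra_simps)
      also have "\<dots> = h x * k x + r x + [:coeff (h x) e ^ N:] * (g x * h x)"
        by (simp only: distrib_left IH(3))
      finally show ?thesis by (simp add: monom_0 algebra_simps)
    qed
    show ?thesis
      using * IH(2,4)
      by (intro exI[of _ "Suc N"] exI[of _ "\<lambda>x. k x + monom (coeff (h x) e ^ N) 0 * g x"] exI[of _ r])
         (auto intro!: poly_family_add poly_family_mult poly_family_monom subalgebra_power
            poly_family_coeff g h R IH(1) simp del: power_Suc)
  qed
qed

text \<open>
  A nonzero member of minimal degree of the ideal generated by \<open>f\<close> and \<open>g\<close> is their greatest
  common divisor over the function field, up to the denominator \<open>c\<close>.
\<close>

lemma poly_family_gcd:
  assumes R: "subalgebra R" and f: "poly_family R f" and g: "poly_family R g"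
    and nz: "x0 \<in> Z" "f x0 \<noteq> 0"
  shows "\<exists>c h u v k l. c \<in> R \<and> poly_family R h \<and> poly_family R k \<and> (\<exists>x\<in>Z. c x \<noteq> 0) \<and>
    (\<forall>x\<in>Z. (c x \<noteq> 0 \<longrightarrow> h x \<noteq> 0) \<and> h x = u x * f x + v x * g x \<and>
       [:c x:] * f x = h x * k x \<and> [:c x:] * g x = h x * l x)"
proof -
  \<comment> \<open>Degree is formal: \<open>P\<close> bounds it on all of \<open>Z\<close>, and
    \<open>Q\<close> asks for a top coefficient that is nonzero somewhere on \<open>Z\<close>,
    although it may vanish at other points.\<close>
  define P where "P e h \<longleftrightarrow> poly_family R h \<and> (\<forall>x\<in>Z. \<forall>i>e. coeff (h x) i = 0) \<and>
    (\<exists>u v. poly_family R u \<and> poly_family R v \<and> (\<forall>x. h x = u x * f x + v x * g x))" for e h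
  define Q where "Q e \<longleftrightarrow> (\<exists>h. P e h \<and> (\<exists>x\<in>Z. coeff (h x) e \<noteq> 0))" for e
  have PQ: "\<exists>e'\<le>e. Q e'" if "P e h" "x \<in> Z" "h x \<noteq> 0" for e h x
    using that(1)
  proof (induction e)
    case 0
    have "coeff (h x) 0 \<noteq> 0"
    proof
      assume "coeff (h x) 0 = 0"
      then have "coeff (h x) i = 0" for i
        using 0 that(2) by (cases "i = 0") (auto simp: P_def)
      with that(3) show False by (simp add: poly_eq_iff)
    qed
    with 0 that(2) show ?case by (auto simp: Q_def)
  next
    case (Suc e)
    show ?case
    proof (cases "\<exists>x\<in>Z. coeff (h x) (Suc e) \<noteq> 0")
      case True
      with Suc.prems show ?thesis by (auto simp: Q_def)
    next
      case False
      then have "coeff (h x) i = 0" if "x \<in> Z" "i > e" for x i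
        using Suc.prems that by (cases "i = Suc e") (auto simp: P_def)
      with Suc.prems have "P e h" by (simp add: P_def)
      with Suc.IH show ?thesis using le_SucI by blast
    qed
  qed
  obtain N where N: "\<And>x. degree (f x) \<le> N"
    using f by (auto simp: poly_family_def)
  have Pf: "P N f"
    unfolding P_def
  proof (intro conjI exI)
    show "\<forall>x\<in>Z. \<forall>i>N. coeff (f x) i = 0"
      using N by (auto intro!: coeff_eq_0 intro: le_less_trans)
    show "poly_family R (\<lambda>x. 1)" "poly_family R (\<lambda>x. 0)" "\<forall>x. f x = 1 * f x + 0 * g x"
      by (simp_all add: poly_family_const R)
  qed (rule f)
  define e where "e = (LEAST e. Q e)"
  have Qe: "Q e"
    unfolding e_def using PQ[OF Pf nz] by (metis LeastI)
  then obtain h where h: "P e h" "\<exists>x\<in>Z. coeff (h x) e \<noteq> 0"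
    by (auto simp: Q_def)
  obtain u v where uv: "poly_family R u" "poly_family R v" "\<And>x. h x = u x * f x + v x * g x"
    using h(1) by (auto simp: P_def)
  have hR: "poly_family R h" and hdeg: "\<And>x i. x \<in> Z \<Longrightarrow> e < i \<Longrightarrow> coeff (h x) i = 0"
    using h(1) by (auto simp: P_def)
  \<comment> \<open>A member of the ideal of formal degree below \<open>e\<close> that is nonzero on
    \<open>Z\<close> would contradict the choice of \<open>e\<close>. This is what kills the
    remainders.\<close>
  have minimal: "r x = 0"
    if r: "poly_family R r" "\<And>x i. x \<in> Z \<Longrightarrow> e \<le> i \<Longrightarrow> coeff (r x) i = 0"
      and ab: "poly_family R a" "poly_family R b" "\<And>x. r x = a x * f x + b x * g x" and x: "x \<in> Z"
    for r a b x
  proof (rule ccontr)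
    assume rx: "r x \<noteq> 0"
    show False
    proof (cases e)
      case 0
      with r x have "coeff (r x) i = 0" for i by simp
      with rx show False by (simp add: poly_eq_iff)
    next
      case (Suc e')
      with r ab have "P e' r" by (auto simp: P_def Suc_le_eq)
      from PQ[OF this x rx] obtain e'' where "e'' \<le> e'" "Q e''" by auto
      moreover from this have "e \<le> e''" by (simp add: e_def Least_le)
      ultimately show False using Suc by simp
    qed
  qed
  have main: "\<exists>N k. poly_family R k \<and> (\<forall>x\<in>Z. [:coeff (h x) e ^ N:] * w x = h x * k x)"
    if w: "poly_family R w" "poly_family R a" "poly_family R b" "\<And>x. w x = a x * f x + b x * g x"
    for w a b
  proof -
    obtain n where n: "\<And>x. degree (w x) < n"
      using w(1) le_imp_less_Suc unfolding poly_family_def by blast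
    have "coeff (w x) i = 0" if "n \<le> i" for x i
      using n that less_le_trans by (blast intro: coeff_eq_0)
    with poly_family_pseudo_division[of R h Z e w n, OF R hR hdeg w(1)] obtain N k r where
      k: "poly_family R k" and r: "poly_family R r" "\<And>x i. x \<in> Z \<Longrightarrow> e \<le> i \<Longrightarrow> coeff (r x) i = 0"
      and eq: "\<And>x. [:coeff (h x) e ^ N:] * w x = h x * k x + r x"
      by metis
    define a' b' where "a' x = monom (coeff (h x) e ^ N) 0 * a x + [:-1:] * (k x * u x)"
      and "b' x = monom (coeff (h x) e ^ N) 0 * b x + [:-1:] * (k x * v x)" for x
    have "r x = a' x * f x + b' x * g x" for x
    proof -
      have "r x = [:coeff (h x) e ^ N:] * (a x * f x + b x * g x) - (u x * f x + v x * g x) * k x"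
        using eq[of x] by (simp only: uv(3)[symmetric] w(4)[symmetric]) (simp add: algebra_simps)
      then show ?thesis by (simp add: a'_def b'_def monom_0 algebra_simps)
    qed
    moreover have "poly_family R a'" "poly_family R b'"
      unfolding a'_def b'_def
      by (intro poly_family_add poly_family_mult poly_family_monom subalgebra_power
          poly_family_coeff poly_family_const k uv w hR R)+
    ultimately have "r x = 0" if "x \<in> Z" for x
      using minimal r that by blast
    with eq k show ?thesis by (intro exI[of _ N] exI[of _ k]) simp
  qed
  obtain N1 k where k: "poly_family R k" "\<And>x. x \<in> Z \<Longrightarrow> [:coeff (h x) e ^ N1:] * f x = h x * k x"
    using main[OF f poly_family_const[OF R, of 1] poly_family_const[OF R, of 0]] by auto
  obtain N2 l where l: "\<And>x. x \<in> Z \<Longrightarrow> [:coeff (h x) e ^ N2:] * g x = h x * l x"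
    using main[OF g poly_family_const[OF R, of 0] poly_family_const[OF R, of 1]] by auto
  \<comment> \<open>The exponent clears both denominators; the extra factor from \<open>Suc\<close>
    makes \<open>c x \<noteq> 0\<close> imply \<open>h x \<noteq> 0\<close> even when
    \<open>N1 + N2 = 0\<close>.\<close>
  define c where "c x = coeff (h x) e ^ Suc (N1 + N2)" for x
  have c1: "[:c x:] = [:coeff (h x) e ^ Suc N2:] * [:coeff (h x) e ^ N1:]"
    and c2: "[:c x:] = [:coeff (h x) e ^ Suc N1:] * [:coeff (h x) e ^ N2:]" for x
    by (simp_all add: c_def power_add)
  show ?thesis
  proof (intro exI conjI ballI)
    show "c \<in> R"
      unfolding c_def by (intro subalgebra_power poly_family_coeff hR R)
    show "poly_family R h" by (rule hR)
    show "poly_family R (\<lambda>x. monom (coeff (h x) e ^ Suc N2) 0 * k x)"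
      by (intro poly_family_mult poly_family_monom subalgebra_power poly_family_coeff hR R k)
    show "\<exists>x\<in>Z. c x \<noteq> 0" using h(2) by (auto simp: c_def)
    fix x assume x: "x \<in> Z"
    show "c x \<noteq> 0 \<longrightarrow> h x \<noteq> 0" by (auto simp: c_def)
    show "h x = u x * f x + v x * g x" by (rule uv)
    show "[:c x:] * f x = h x * (monom (coeff (h x) e ^ Suc N2) 0 * k x)"
      unfolding c1 mult.assoc k(2)[OF x] monom_0 by (simp add: algebra_simps)
    show "[:c x:] * g x = h x * ([:coeff (h x) e ^ Suc N1:] * l x)"
      unfolding c2 mult.assoc l[OF x] by (simp add: algebra_simps)
  qed
qed

text \<open>If \<open>a\<close> is a root of \<open>f\<close> of order \<open>m\<close>, its order
  in \<open>pderiv f\<close> is \<open>m - 1\<close>, by characteristic zero. As \<open>h\<close>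
  divides a nonzero multiple of \<open>pderiv f\<close>, its order at \<open>a\<close> is at most
  \<open>m - 1\<close>, so a factor \<open>t - a\<close> of \<open>f\<close> is left for
  \<open>k\<close>.\<close>

lemma double_root_cofactor:
  fixes f h k l u v :: "complex poly"
  assumes "c \<noteq> 0" "h \<noteq> 0" "h = u * f + v * pderiv f" "[:c:] * f = h * k"
    "[:c:] * pderiv f = h * l" "poly f a = 0" "poly (pderiv f) a = 0"
  shows "poly h a = 0 \<and> poly k a = 0"
proof
  show "poly h a = 0" using assms by simp
  show "poly k a = 0"
  proof (rule ccontr)
    assume k: "poly k a \<noteq> 0"
    have f: "f \<noteq> 0" using assms(2,3) by auto
    then have "degree f \<noteq> 0" using assms(6) by (metis degree_eq_zeroE mult_zero_right add.right_neutral
      pCons_0_0 poly_0 poly_pCons)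
    then have f': "pderiv f \<noteq> 0" by (simp add: pderiv_eq_0_iff)
    have c: "[:c:] \<noteq> 0" "order a [:c:] = 0" using assms(1) by (auto simp: order_0I)
    have "order a f = order a ([:c:] * f)" using f c order_mult[of "[:c:]" f a] by (simp del: mult_pCons_left)
    also have "\<dots> = order a h"
      using assms(2,4) k f c by (metis add.right_neutral mult_eq_0_iff order_0I order_mult)
    also have "\<dots> \<le> order a ([:c:] * pderiv f)"
      using assms(5) f' c by (metis dvd_imp_order_le dvd_triv_left mult_eq_0_iff)
    also have "\<dots> = order a (pderiv f)" using f' c order_mult[of "[:c:]" "pderiv f" a] by (simp del: mult_pCons_left)
    also have "\<dots> < order a f"
      using Polynomial.order_pderiv[OF f assms(6)] by simp
    finally show False by simp
  qed
qed

text \<open>Modelled on tangent vectors at \<open>x\<close> to the closure of \<open>Z\<close>. The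
  second clause makes \<open>\<delta>\<close> depend on restrictions to \<open>Z\<close> only, so
  that the identity \<open>c f = h k\<close>, known on \<open>Z\<close>, can be
  differentiated.\<close>

definition derivation_at ::
    "('x \<Rightarrow> complex) set \<Rightarrow> 'x set \<Rightarrow> 'x \<Rightarrow> (('x \<Rightarrow> complex) \<Rightarrow> complex) \<Rightarrow> bool" where
  "derivation_at R Z x \<delta> \<longleftrightarrow>
     (\<forall>r\<in>R. \<forall>s\<in>R. \<delta> (\<lambda>y. r y * s y) = r x * \<delta> s + \<delta> r * s x) \<and>
     (\<forall>r\<in>R. \<forall>s\<in>R. (\<forall>y\<in>Z. r y = s y) \<longrightarrow> \<delta> r = \<delta> s)"

text \<open>
  Over the function field the greatest common divisor of \<open>f\<close> and \<open>f'\<close> divides every derivative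
  of \<open>f\<close> with respect to the parameters; this is where characteristic zero enters.
\<close>

lemma derivation_vanishes_at_double_root:
  assumes R: "subalgebra R" and f: "poly_family R f" and "Z \<noteq> {}"
  shows "\<exists>c\<in>R. (\<exists>x\<in>Z. c x \<noteq> 0) \<and>
    (\<forall>x\<in>Z. c x \<noteq> 0 \<longrightarrow> (\<forall>a \<delta>. poly (f x) a = 0 \<longrightarrow> poly (pderiv (f x)) a = 0 \<longrightarrow>
      derivation_at R Z x \<delta> \<longrightarrow> \<delta> (\<lambda>y. poly (f y) a) = 0))"
proof (cases "\<forall>x\<in>Z. f x = 0")
  \<comment> \<open>If \<open>f\<close> is zero on \<open>Z\<close>, there is no nonzero greatest
    common divisor to choose; but then \<open>\<delta>\<close> sees the zero function, and
    \<open>c = 1\<close> works.\<close>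
  case True
  have "\<delta> (\<lambda>y. poly (f y) a) = 0"
    if \<delta>: "derivation_at R Z x \<delta>" for \<delta> x a
  proof -
    have "\<delta> (\<lambda>y. poly (f y) a) = \<delta> (\<lambda>y. 0)"
      by (rule \<delta>[unfolded derivation_at_def, THEN conjunct2, rule_format])
        (simp_all add: True poly_family_poly[OF R f] subalgebra_const[OF R])
    moreover have "\<delta> (\<lambda>y. 0 * 0) = 0 * \<delta> (\<lambda>y. 0) + \<delta> (\<lambda>y. 0) * 0"
      using \<delta>[unfolded derivation_at_def, THEN conjunct1, rule_format, of "\<lambda>y. 0" "\<lambda>y. 0"]
        subalgebra_const[OF R, of 0] by simp
    ultimately show ?thesis by simp
  qed
  note vanish = this
  show ?thesis
  proof (rule bexI[of _ "\<lambda>x. 1"], intro conjI ballI impI allI)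
    show "(\<lambda>x. 1) \<in> R" by (rule subalgebra_const[OF R])
    show "\<exists>x\<in>Z. (1::complex) \<noteq> 0" using \<open>Z \<noteq> {}\<close> by auto
  qed (rule vanish)
next
  case False
  then obtain x0 where "x0 \<in> Z" "f x0 \<noteq> 0" by auto
  from poly_family_gcd[OF R f poly_family_pderiv[OF R f] this] obtain c h u v k l where
    *: "c \<in> R \<and> poly_family R h \<and> poly_family R k \<and> (\<exists>x\<in>Z. c x \<noteq> 0) \<and>
      (\<forall>x\<in>Z. (c x \<noteq> 0 \<longrightarrow> h x \<noteq> 0) \<and> h x = u x * f x + v x * pderiv (f x) \<and>
        [:c x:] * f x = h x * k x \<and> [:c x:] * pderiv (f x) = h x * l x)"
    by (elim exE)
  then have c: "c \<in> R" "\<exists>x\<in>Z. c x \<noteq> 0" and h: "poly_family R h" and k: "poly_family R k"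
    by simp_all
  have eqs: "c x \<noteq> 0 \<Longrightarrow> h x \<noteq> 0" "h x = u x * f x + v x * pderiv (f x)"
    "[:c x:] * f x = h x * k x" "[:c x:] * pderiv (f x) = h x * l x" if "x \<in> Z" for x
    using * that by blast+
  have "\<delta> (\<lambda>y. poly (f y) a) = 0"
    if x: "x \<in> Z" "c x \<noteq> 0" and a: "poly (f x) a = 0" "poly (pderiv (f x)) a = 0"
      and \<delta>: "derivation_at R Z x \<delta>"
    for \<delta> x a
  proof -
    have Leibniz: "\<forall>r\<in>R. \<forall>s\<in>R. \<delta> (\<lambda>y. r y * s y) = r x * \<delta> s + \<delta> r * s x"
      and cong: "\<forall>r\<in>R. \<forall>s\<in>R. (\<forall>y\<in>Z. r y = s y) \<longrightarrow> \<delta> r = \<delta> s"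
      using \<delta> unfolding derivation_at_def by (rule conjunct1, rule conjunct2)
    have hk: "poly (h x) a = 0" "poly (k x) a = 0"
      using double_root_cofactor[OF x(2) eqs(1)[OF x(1) x(2)] eqs(2)[OF x(1)] eqs(3)[OF x(1)] eqs(4)[OF x(1)] a]
      by auto
    note fR = poly_family_poly[OF R f, of a] and hR = poly_family_poly[OF R h, of a]
      and kR = poly_family_poly[OF R k, of a]
    have "c y * poly (f y) a = poly (h y) a * poly (k y) a" if "y \<in> Z" for y
      using arg_cong[OF eqs(3)[OF that], of "\<lambda>p. poly p a"] by simp
    then have "\<delta> (\<lambda>y. c y * poly (f y) a) = \<delta> (\<lambda>y. poly (h y) a * poly (k y) a)"
      by (intro cong[rule_format] subalgebra_mult[OF R] c(1) fR hR kR)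
    moreover have "\<delta> (\<lambda>y. poly (h y) a * poly (k y) a) = 0"
      using Leibniz[rule_format, OF hR kR] hk by simp
    moreover have "\<delta> (\<lambda>y. c y * poly (f y) a) = c x * \<delta> (\<lambda>y. poly (f y) a)"
      using Leibniz[rule_format, OF c(1) fR] a by simp
    ultimately show ?thesis using x(2) by simp
  qed
  note vanish = this
  show ?thesis
  proof (rule bexI[of _ c], intro conjI ballI impI allI)
    show "c \<in> R" "\<exists>x\<in>Z. c x \<noteq> 0" by (rule c)+
  qed (rule vanish)
qed

section \<open>Polynomial functions and their derivatives\<close>

lemma eval_at_superset:
  assumes "finite K" "Poly_Mapping.keys Q \<subseteq> K"
  shows "eval_at Q x = (\<Sum>m\<in>K. Poly_Mapping.lookup Q m * (\<Prod>i\<in>UNIV. x i ^ Poly_Mapping.lookup m i))"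
  unfolding eval_in_def using assms
  by (intro sum.mono_neutral_left) (auto simp: in_keys_iff)

lemma eval_at_single:
  "eval_at (Poly_Mapping.single m c) x = c * (\<Prod>i\<in>UNIV. x i ^ Poly_Mapping.lookup m i)"
  by (subst eval_at_superset[where K = "{m}"]) auto

lemma eval_at_add: "eval_at (F + G) x = eval_at F x + eval_at G x"
proof -
  let ?K = "Poly_Mapping.keys F \<union> Poly_Mapping.keys G"
  have K: "finite ?K" "Poly_Mapping.keys (F + G) \<subseteq> ?K"
    by (simp_all add: Poly_Mapping.keys_add)
  show ?thesis
    unfolding eval_at_superset[OF K]
      eval_at_superset[of ?K F, OF K(1) Un_upper1] eval_at_superset[of ?K G, OF K(1) Un_upper2]
    by (simp add: lookup_add distrib_right sum.distrib)
qed

lemma eval_at_zero [simp]: "eval_at 0 x = 0"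
  by (simp add: eval_in_def)

lemma eval_at_sum: "eval_at (\<Sum>i\<in>I. F i) x = (\<Sum>i\<in>I. eval_at (F i) x)"
  by (induction I rule: infinite_finite_induct) (simp_all add: eval_at_add)

lemma eval_at_mult_ex: "\<exists>H. \<forall>x. eval_at H x = eval_at F x * eval_at G x"
proof
  define H where "H = (\<Sum>m\<in>Poly_Mapping.keys F. \<Sum>m'\<in>Poly_Mapping.keys G.
    Poly_Mapping.single (m + m') (Poly_Mapping.lookup F m * Poly_Mapping.lookup G m'))"
  show "\<forall>x. eval_at H x = eval_at F x * eval_at G x"
  proof
    fix x
    show "eval_at H x = eval_at F x * eval_at G x"
      unfolding eval_in_def[of _ F] eval_in_def[of _ G] H_def eval_at_sum eval_at_single
        sum_product lookup_add power_add prod.distrib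
      by (simp add: mult_ac)
  qed
qed

lemma subalgebra_polynomial_functions: "subalgebra (range eval_at)"
proof -
  have "(\<lambda>x. c) \<in> range eval_at" for c
    by (intro range_eqI[of _ _ "Poly_Mapping.single 0 c"]) (simp add: eval_at_single fun_eq_iff)
  moreover have "(\<lambda>x. f x + g x) \<in> range eval_at \<and> (\<lambda>x. f x * g x) \<in> range eval_at"
    if fg: "f \<in> range eval_at" "g \<in> range eval_at" for f g
  proof -
    obtain F G where FG: "f = eval_at F" "g = eval_at G" using fg by blast
    have "(\<lambda>x. f x + g x) = eval_at (F + G)"
      by (simp add: FG eval_at_add fun_eq_iff)
    moreover obtain H where "\<forall>x. eval_at H x = eval_at F x * eval_at G x"
      using eval_at_mult_ex by blast
    then have "(\<lambda>x. f x * g x) = eval_at H" by (simp add: FG fun_eq_iff)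
    ultimately show ?thesis by blast
  qed
  ultimately show ?thesis unfolding subalgebra_def by blast
qed

lemma coordinate_polynomial_function: "(\<lambda>x. x i) \<in> range eval_at"
proof -
  have "(\<lambda>x. x i) = eval_at (Poly_Mapping.single (Poly_Mapping.single i 1) 1)"
  proof
    fix x :: "'a \<Rightarrow> complex"
    have "(\<Prod>j\<in>UNIV. x j ^ Poly_Mapping.lookup (Poly_Mapping.single i 1) j) =
        (\<Prod>j\<in>UNIV. if j = i then x j else 1)"
      by (intro prod.cong) (auto simp: lookup_single when_def)
    then show "x i = eval_at (Poly_Mapping.single (Poly_Mapping.single i 1) 1) x"
      by (simp add: eval_at_single)
  qed
  then show ?thesis by (rule range_eqI)
qed

lemma eval_at_homogeneous:
  assumes "homogeneous d F"
  shows "eval_at F (\<lambda>i. c * x i) = c ^ d * eval_at F x"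
  using assms unfolding eval_in_def homogeneous_def sum_distrib_left
  by (intro sum.cong)
     (auto simp: power_mult_distrib prod.distrib mult_ac simp flip: power_sum)

text \<open>The formal partial derivative. For a monomial without the variable \<open>i\<close> the
  truncated subtraction leaves the exponents unchanged, but the coefficient is then zero.\<close>

definition partial :: "'i \<Rightarrow> ('i::finite) mpoly \<Rightarrow> 'i mpoly" where
  "partial i Q = (\<Sum>m\<in>Poly_Mapping.keys Q.
     Poly_Mapping.single (m - Poly_Mapping.single i 1)
       (of_nat (Poly_Mapping.lookup m i) * Poly_Mapping.lookup Q m))"

lemma prod_lookup_minus_single:
  fixes x :: "'i::finite \<Rightarrow> complex"
  shows "(\<Prod>j\<in>UNIV. x j ^ Poly_Mapping.lookup (m - Poly_Mapping.single i 1) j) =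
    x i ^ (Poly_Mapping.lookup m i - 1) * (\<Prod>j\<in>UNIV - {i}. x j ^ Poly_Mapping.lookup m j)"
  by (subst prod.remove[of UNIV i])
     (auto simp: lookup_minus lookup_single when_def intro!: prod.cong)

lemma DERIV_eval_at:
  assumes x: "\<And>i. ((\<lambda>t. x t i) has_field_derivative x' i) (at t0)"
  shows "((\<lambda>t. eval_at Q (x t)) has_field_derivative
    (\<Sum>i\<in>UNIV. eval_at (partial i Q) (x t0) * x' i)) (at t0)"
proof -
  have "((\<lambda>t. \<Prod>i\<in>UNIV. x t i ^ Poly_Mapping.lookup m i) has_field_derivative
      (\<Sum>i\<in>UNIV. (of_nat (Poly_Mapping.lookup m i) * (x' i * x t0 i ^ (Poly_Mapping.lookup m i - Suc 0))) *
         (\<Prod>j\<in>UNIV - {i}. x t0 j ^ Poly_Mapping.lookup m j))) (at t0)" for m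
    by (intro has_field_derivative_prod DERIV_power x)
  then have "((\<lambda>t. eval_at Q (x t)) has_field_derivative
      (\<Sum>m\<in>Poly_Mapping.keys Q. Poly_Mapping.lookup Q m *
      (\<Sum>i\<in>UNIV. (of_nat (Poly_Mapping.lookup m i) * (x' i * x t0 i ^ (Poly_Mapping.lookup m i - Suc 0))) *
         (\<Prod>j\<in>UNIV - {i}. x t0 j ^ Poly_Mapping.lookup m j)))) (at t0)"
    unfolding eval_in_def by (intro DERIV_sum DERIV_cmult)
  moreover have "(\<Sum>m\<in>Poly_Mapping.keys Q. Poly_Mapping.lookup Q m *
      (\<Sum>i\<in>UNIV. (of_nat (Poly_Mapping.lookup m i) * (x' i * x t0 i ^ (Poly_Mapping.lookup m i - Suc 0))) *
         (\<Prod>j\<in>UNIV - {i}. x t0 j ^ Poly_Mapping.lookup m j))) =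
      (\<Sum>i\<in>UNIV. eval_at (partial i Q) (x t0) * x' i)"
    unfolding partial_def eval_at_sum eval_at_single prod_lookup_minus_single
      sum_distrib_left sum_distrib_right
    by (subst sum.swap) (intro sum.cong refl, simp add: mult_ac)
  ultimately show ?thesis by simp
qed

text \<open>Each surviving monomial comes from one with positive exponent at \<open>i\<close>, so
  its degree drops by exactly one. For \<open>d = 0\<close> nothing survives, and the truncated
  \<open>d - 1\<close> is harmless.\<close>

lemma homogeneous_partial:
  assumes "homogeneous d Q"
  shows "homogeneous (d - 1) (partial i Q)"
  unfolding homogeneous_def
proof
  fix m' assume "m' \<in> Poly_Mapping.keys (partial i Q)"
  then have "(\<Sum>m\<in>Poly_Mapping.keys Q. Poly_Mapping.lookup (Poly_Mapping.single (m - Poly_Mapping.single i 1)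
       (of_nat (Poly_Mapping.lookup m i) * Poly_Mapping.lookup Q m)) m') \<noteq> 0"
    by (simp add: partial_def in_keys_iff lookup_sum)
  then obtain m where m: "m \<in> Poly_Mapping.keys Q"
    "Poly_Mapping.lookup (Poly_Mapping.single (m - Poly_Mapping.single i 1)
       (of_nat (Poly_Mapping.lookup m i) * Poly_Mapping.lookup Q m)) m' \<noteq> 0"
    by (auto elim!: sum.not_neutral_contains_not_neutral)
  then have m': "m' = m - Poly_Mapping.single i 1" and pos: "Poly_Mapping.lookup m i > 0"
    by (auto simp: lookup_single when_def split: if_splits)
  have "(\<Sum>j\<in>UNIV. Poly_Mapping.lookup m j) =
      Poly_Mapping.lookup m i + (\<Sum>j\<in>UNIV - {i}. Poly_Mapping.lookup m j)"
    by (simp add: sum.remove)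
  moreover have "(\<Sum>j\<in>UNIV. Poly_Mapping.lookup m' j) =
      (Poly_Mapping.lookup m i - 1) + (\<Sum>j\<in>UNIV - {i}. Poly_Mapping.lookup m j)"
    unfolding m'
    by (subst sum.remove[of UNIV i])
       (auto simp: lookup_minus lookup_single when_def intro!: sum.cong)
  ultimately show "(\<Sum>j\<in>UNIV. Poly_Mapping.lookup m' j) = d - 1"
    using assms m(1) pos by (auto simp: homogeneous_def)
qed

text \<open>Lowering the exponent of \<open>i\<close> is injective on the monomials that contain
  this variable, so no terms merge. In characteristic zero the coefficient of \<open>m\<close> can
  thus be recovered from the derivative.\<close>

lemma lookup_partial:
  assumes "Poly_Mapping.lookup m i > 0"
  shows "Poly_Mapping.lookup (partial i Q) (m - Poly_Mapping.single i 1) =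
    of_nat (Poly_Mapping.lookup m i) * Poly_Mapping.lookup Q m"
proof -
  have eq: "m' = m"
    if "m' - Poly_Mapping.single i 1 = m - Poly_Mapping.single i 1" "Poly_Mapping.lookup m' i > 0" for m'
  proof (rule poly_mapping_eqI)
    fix j
    have "Poly_Mapping.lookup (m' - Poly_Mapping.single i 1) j =
        Poly_Mapping.lookup (m - Poly_Mapping.single i 1) j"
      by (simp only: that(1))
    then show "Poly_Mapping.lookup m' j = Poly_Mapping.lookup m j"
      using that(2) assms by (cases "j = i") (auto simp: lookup_minus lookup_single when_def)
  qed
  have "Poly_Mapping.lookup (partial i Q) (m - Poly_Mapping.single i 1) =
      (\<Sum>m'\<in>Poly_Mapping.keys Q. if m' = m then of_nat (Poly_Mapping.lookup m i) * Poly_Mapping.lookup Q m else 0)"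
    unfolding partial_def lookup_sum
  proof (intro sum.cong refl)
    fix m' assume "m' \<in> Poly_Mapping.keys Q"
    show "Poly_Mapping.lookup (Poly_Mapping.single (m' - Poly_Mapping.single i 1)
        (of_nat (Poly_Mapping.lookup m' i) * Poly_Mapping.lookup Q m')) (m - Poly_Mapping.single i 1) =
      (if m' = m then of_nat (Poly_Mapping.lookup m i) * Poly_Mapping.lookup Q m else 0)"
      using eq[of m'] by (cases "Poly_Mapping.lookup m' i = 0") (auto simp: lookup_single when_def)
  qed
  then show ?thesis
    by (simp add: in_keys_iff)
qed

lemma homogeneous_0_if_partial_zero:
  assumes "\<And>i. partial i Q = 0"
  shows "homogeneous 0 Q"
  unfolding homogeneous_def
proof
  fix m assume m: "m \<in> Poly_Mapping.keys Q"
  have "Poly_Mapping.lookup m i = 0" for i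
    using lookup_partial[of m i Q] m assms by (auto simp: in_keys_iff)
  then show "(\<Sum>i\<in>UNIV. Poly_Mapping.lookup m i) = 0" by simp
qed

section \<open>Derivatives of a polynomial along a line\<close>

lemma poly_along: "poly (along Q x y) t = eval_at Q (\<lambda>i. x i + t * y i)"
  by (simp add: along_def eval_in_def poly_sum poly_prod poly_power mult.commute)

lemma poly_pderiv_along:
  "poly (pderiv (along Q x y)) t = (\<Sum>i\<in>UNIV. eval_at (partial i Q) (\<lambda>i. x i + t * y i) * y i)"
proof -
  have "((\<lambda>t. eval_at Q (\<lambda>i. x i + t * y i)) has_field_derivative
      (\<Sum>i\<in>UNIV. eval_at (partial i Q) (\<lambda>i. x i + t * y i) * y i)) (at t)"
    by (rule DERIV_eval_at) (auto intro!: derivative_eq_intros)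
  from DERIV_unique[OF this poly_DERIV[of "along Q x y" t, unfolded poly_along]]
  show ?thesis by simp
qed

lemma poly_pderiv_pderiv_along:
  "poly (pderiv (pderiv (along Q x y))) t =
    (\<Sum>i\<in>UNIV. (\<Sum>j\<in>UNIV. eval_at (partial j (partial i Q)) (\<lambda>i. x i + t * y i) * y j) * y i)"
proof -
  have "((\<lambda>t. \<Sum>i\<in>UNIV. eval_at (partial i Q) (\<lambda>i. x i + t * y i) * y i) has_field_derivative
      (\<Sum>i\<in>UNIV. (\<Sum>j\<in>UNIV. eval_at (partial j (partial i Q)) (\<lambda>i. x i + t * y i) * y j) * y i)) (at t)"
    by (intro DERIV_sum DERIV_cmult_right DERIV_eval_at) (auto intro!: derivative_eq_intros)
  from DERIV_unique[OF this poly_DERIV[of "pderiv (along Q x y)" t, unfolded poly_pderiv_along]]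
  show ?thesis by simp
qed

lemma pderiv_sum: "pderiv (\<Sum>i\<in>I. f i) = (\<Sum>i\<in>I. pderiv (f i))"
  by (induction I rule: infinite_finite_induct) (simp_all add: pderiv_add)

lemma X_power_dvd_pderiv:
  fixes p :: "complex poly"
  assumes "[:0, 1:] ^ Suc n dvd p"
  shows "[:0, 1:] ^ n dvd pderiv p"
proof -
  obtain r where r: "p = [:0, 1:] ^ Suc n * r" using assms by (elim dvdE)
  have "pderiv p = [:0, 1:] ^ n * ([:0, 1:] * pderiv r + smult (of_nat (Suc n)) (pderiv [:0, 1:]) * r)"
    unfolding r pderiv_mult pderiv_power_Suc
    by (simp add: algebra_simps del: mult_pCons_left mult_pCons_right of_nat_Suc)
  then show ?thesis by (metis dvd_triv_left)
qed

lemma X_dvd_iff: "[:0, 1:] dvd p \<longleftrightarrow> poly p 0 = 0" for p :: "complex poly"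
  using poly_eq_0_iff_dvd[of p 0] by simp

lemma X_square_dvd_iff:
  "[:0, 1:] ^ 2 dvd p \<longleftrightarrow> poly p 0 = 0 \<and> poly (pderiv p) 0 = 0" for p :: "complex poly"
proof
  assume p: "[:0, 1:] ^ 2 dvd p"
  then have "[:0, 1:] ^ Suc 1 dvd p" by (simp add: numeral_2_eq_2)
  then have "[:0, 1:] dvd pderiv p" using X_power_dvd_pderiv[of 1 p] by simp
  moreover have "[:0, 1:] dvd p" using p by (simp add: power2_eq_square dvd_mult_left)
  ultimately show "poly p 0 = 0 \<and> poly (pderiv p) 0 = 0" by (simp only: X_dvd_iff)
next
  assume p: "poly p 0 = 0 \<and> poly (pderiv p) 0 = 0"
  then obtain r where r: "p = [:0, 1:] * r" unfolding X_dvd_iff[symmetric] by (elim conjE dvdE)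
  have "pderiv p = [:0, 1:] * pderiv r + r"
    unfolding r pderiv_mult by (simp add: pderiv_pCons)
  with p have "poly r 0 = 0" by simp
  then have "[:0, 1:] dvd r" by (simp only: X_dvd_iff)
  then show "[:0, 1:] ^ 2 dvd p" unfolding r power2_eq_square by (intro mult_dvd_mono dvd_refl)
qed

lemma X_cube_dvd_imp:
  assumes "[:0, 1:] ^ 3 dvd (p :: complex poly)"
  shows "poly (pderiv (pderiv p)) 0 = 0"
proof -
  have "[:0, 1:] ^ Suc 2 dvd p" using assms by (simp add: numeral_3_eq_3)
  from X_power_dvd_pderiv[OF this] show ?thesis by (simp only: X_square_dvd_iff)
qed

section \<open>Tangent vectors and charts of the Grassmannian\<close>

definition regular_functions :: "(('n::finite) eqs \<Rightarrow> complex) set" where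
  "regular_functions = {r. \<exists>Q. \<forall>A. r A = eval_at Q (entries A)}"

lemma subalgebra_regular: "subalgebra regular_functions"
proof -
  have eq: "regular_functions = (\<lambda>f A. f (entries A)) ` range eval_at"
    by (auto simp: regular_functions_def fun_eq_iff image_iff)
  note P = subalgebra_polynomial_functions
  show ?thesis
    unfolding subalgebra_def
  proof (intro conjI allI ballI)
    fix c show "(\<lambda>x. c) \<in> (regular_functions :: ('a eqs \<Rightarrow> complex) set)"
      unfolding eq by (rule image_eqI[OF _ subalgebra_const[OF P, of c]]) simp
  next
    fix f g :: "'a eqs \<Rightarrow> complex"
    assume "f \<in> regular_functions" "g \<in> regular_functions"
    then obtain f' g' where fg: "f = (\<lambda>A. f' (entries A))" "g = (\<lambda>A. g' (entries A))"
      "f' \<in> range eval_at" "g' \<in> range eval_at"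
      unfolding eq by (elim imageE) simp
    show "(\<lambda>x. f x + g x) \<in> regular_functions"
      unfolding eq by (rule image_eqI[OF _ subalgebra_add[OF P fg(3,4)]]) (simp add: fg(1,2))
    show "(\<lambda>x. f x * g x) \<in> regular_functions"
      unfolding eq by (rule image_eqI[OF _ subalgebra_mult[OF P fg(3,4)]]) (simp add: fg(1,2))
  qed
qed

lemma entry_regular: "(\<lambda>A. A $ i $ k) \<in> regular_functions"
proof -
  obtain Q where "(\<lambda>x. x (i, k)) = eval_at Q"
    using coordinate_polynomial_function[of "(i, k)"] by auto
  then have "A $ i $ k = eval_at Q (entries A)" for A
    unfolding entries_def by (auto simp: fun_eq_iff dest: spec[of _ "\<lambda>(i, k). A $ i $ k"])
  then show ?thesis by (auto simp: regular_functions_def)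
qed

definition shift :: "('n::finite) eqs \<Rightarrow> 'n eqs \<Rightarrow> complex \<Rightarrow> 'n eqs" where
  "shift A B t = (\<chi> i. A $ i + t *s B $ i)"

lemma entries_shift: "entries (shift A B t) = (\<lambda>i. entries A i + t * entries B i)"
  by (auto simp: entries_def shift_def)

lemma shift_0 [simp]: "shift A B 0 = A"
  by (simp add: shift_def vec_eq_iff)

lemma shift_vector_mult: "shift A B t *v z = A *v z + t *s (B *v z)"
  by (simp add: shift_def matrix_vector_mult_def vec_eq_iff sum.distrib sum_distrib_left
      distrib_right mult.assoc)

text \<open>Taken analytically so that the usual differentiation rules apply. It is meaningful on
  \<open>regular_functions\<close>, which are polynomial in \<open>t\<close> along
  \<open>A + t B\<close>.\<close>

definition tangent_derivative ::
    "('n::finite) eqs \<Rightarrow> 'n eqs \<Rightarrow> ('n eqs \<Rightarrow> complex) \<Rightarrow> complex" where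
  "tangent_derivative A B r = deriv (\<lambda>t. r (shift A B t)) 0"

lemma DERIV_shift:
  assumes "r \<in> regular_functions"
  shows "((\<lambda>t. r (shift A B t)) has_field_derivative tangent_derivative A B r) (at 0)"
proof -
  obtain Q where Q: "\<And>A. r A = eval_at Q (entries A)"
    using assms by (auto simp: regular_functions_def)
  have "((\<lambda>t. eval_at Q (entries (shift A B t))) has_field_derivative
      (\<Sum>i\<in>UNIV. eval_at (partial i Q) (entries (shift A B 0)) * entries B i)) (at 0)"
    by (rule DERIV_eval_at) (auto simp: entries_shift intro!: derivative_eq_intros)
  then show ?thesis
    unfolding Q[symmetric] tangent_derivative_def using DERIV_imp_deriv by fastforce
qed

lemma tangent_derivative_eqI:
  "((\<lambda>t. r (shift A B t)) has_field_derivative D) (at 0) \<Longrightarrow> tangent_derivative A B r = D"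
  unfolding tangent_derivative_def by (rule DERIV_imp_deriv)

lemma tangent_derivative_entry: "tangent_derivative A B (\<lambda>A. A $ i $ k) = B $ i $ k"
  by (rule tangent_derivative_eqI) (auto simp: shift_def intro!: derivative_eq_intros)

lemma tangent_derivative_mult:
  "r \<in> regular_functions \<Longrightarrow> s \<in> regular_functions \<Longrightarrow>
    tangent_derivative A B (\<lambda>y. r y * s y) = r A * tangent_derivative A B s + tangent_derivative A B r * s A"
  by (rule tangent_derivative_eqI)
     (auto intro!: derivative_eq_intros DERIV_shift simp: algebra_simps)

lemma tangent_derivative_add:
  "r \<in> regular_functions \<Longrightarrow> s \<in> regular_functions \<Longrightarrow>
    tangent_derivative A B (\<lambda>y. r y + s y) = tangent_derivative A B r + tangent_derivative A B s"
  by (rule tangent_derivative_eqI) (auto intro!: derivative_eq_intros DERIV_shift)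

lemma tangent_derivative_sum:
  assumes "\<And>i. i \<in> I \<Longrightarrow> (\<lambda>y. r i y) \<in> regular_functions"
  shows "tangent_derivative A B (\<lambda>y. \<Sum>i\<in>I. r i y) = (\<Sum>i\<in>I. tangent_derivative A B (r i))"
  by (rule tangent_derivative_eqI) (intro DERIV_sum DERIV_shift assms)

lemma tangent_derivative_eval_at:
  assumes "\<And>i. (\<lambda>y. g y i) \<in> regular_functions"
  shows "tangent_derivative A B (\<lambda>y. eval_at Q (g y)) =
    (\<Sum>i\<in>UNIV. eval_at (partial i Q) (g A) * tangent_derivative A B (\<lambda>y. g y i))"
  using DERIV_eval_at[of "\<lambda>t. g (shift A B t)" _ 0 Q, OF DERIV_shift[OF assms]]
  by (intro tangent_derivative_eqI) simp

lemma frame_tangent_iff: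
  "B \<in> frame_tangent S A \<longleftrightarrow> (\<forall>Q. (\<forall>A'\<in>frames S. eval_at Q (entries A') = 0) \<longrightarrow>
     eval_at Q (entries A) = 0 \<and> (\<Sum>i\<in>UNIV. eval_at (partial i Q) (entries A) * entries B i) = 0)"
  unfolding frame_tangent_def X_square_dvd_iff poly_along poly_pderiv_along by simp

text \<open>The difference of \<open>r\<close> and \<open>s\<close> is a polynomial vanishing on
  \<open>frames S\<close>; tangency of \<open>B\<close> says that such a polynomial has no linear
  term along \<open>A + t B\<close>.\<close>

lemma tangent_derivative_cong:
  assumes B: "B \<in> frame_tangent S A"
    and r: "r \<in> regular_functions" and s: "s \<in> regular_functions"
    and eq: "\<And>A'. A' \<in> frames S \<Longrightarrow> r A' = s A'"
  shows "tangent_derivative A B r = tangent_derivative A B s"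
proof -
  define w where "w A = r A + (- 1) * s A" for A
  have w: "w \<in> regular_functions"
    unfolding w_def
    by (intro subalgebra_add subalgebra_mult subalgebra_const r s subalgebra_regular)
  then obtain Q where Q: "\<And>A. w A = eval_at Q (entries A)"
    by (auto simp: regular_functions_def)
  have "\<forall>A'\<in>frames S. eval_at Q (entries A') = 0"
    by (simp add: Q[symmetric] w_def eq)
  then have *: "[:0, 1:] ^ 2 dvd along Q (entries A) (entries B)"
    using B by (auto simp: frame_tangent_def)
  have "((\<lambda>t. w (shift A B t)) has_field_derivative 0) (at 0)"
    using poly_DERIV[of "along Q (entries A) (entries B)" 0] *
    unfolding X_square_dvd_iff poly_along by (simp add: Q entries_shift)
  then have "tangent_derivative A B w = 0" by (rule tangent_derivative_eqI)
  moreover have "tangent_derivative A B w = tangent_derivative A B r - tangent_derivative A B s"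
    unfolding w_def
    by (rule tangent_derivative_eqI) (auto intro!: derivative_eq_intros DERIV_shift r s)
  ultimately show ?thesis by simp
qed

text \<open>
  The chart of the Grassmannian on which \<open>x\<^sub>k\<close> and \<open>x\<^sub>l\<close> are coordinates on the line; the
  columns of the adjugate matrix give points of the line depending polynomially on the equations.
\<close>

definition chart_matrix ::
    "'n option option \<Rightarrow> 'n option option \<Rightarrow> ('n::finite) eqs \<Rightarrow> complex ^ 'n option option ^ 'n option option" where
  "chart_matrix k l A =
    (\<chi> r. case r of None \<Rightarrow> axis k 1 | Some None \<Rightarrow> axis l 1 | Some (Some i) \<Rightarrow> A $ i)"

definition chart_det :: "'n option option \<Rightarrow> 'n option option \<Rightarrow> ('n::finite) eqs \<Rightarrow> complex" where
  "chart_det k l A = det (chart_matrix k l A)"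

definition chart_vec ::
    "'n option option \<Rightarrow> 'n option option \<Rightarrow> 'n option option \<Rightarrow> ('n::finite) eqs \<Rightarrow> 'n hvec" where
  "chart_vec k l r A =
    (\<chi> j. det (\<chi> i j'. if j' = j then axis r 1 $ i else chart_matrix k l A $ i $ j'))"

lemma chart_matrix_regular: "(\<lambda>A. chart_matrix k l A $ i $ j) \<in> regular_functions"
proof (cases i)
  case (Some i')
  then show ?thesis
    by (cases i') (simp_all add: chart_matrix_def entry_regular subalgebra_const[OF subalgebra_regular])
qed (simp add: chart_matrix_def subalgebra_const[OF subalgebra_regular])

lemma chart_det_regular: "chart_det k l \<in> regular_functions"
  unfolding chart_det_def[abs_def] by (intro subalgebra_det chart_matrix_regular subalgebra_regular)

lemma chart_vec_regular: "(\<lambda>A. chart_vec k l r A $ j) \<in> regular_functions"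
proof -
  have "(\<lambda>A. (\<chi> i j'. if j' = j then axis r 1 $ i else chart_matrix k l A $ i $ j') $ i $ j')
      \<in> regular_functions" for i j'
    by (cases "j' = j") (simp_all add: chart_matrix_regular subalgebra_const[OF subalgebra_regular])
  then show ?thesis
    by (simp add: chart_vec_def) (intro subalgebra_det subalgebra_regular, simp)
qed

lemma axis_mult_sum: "(\<Sum>j\<in>UNIV. axis k (1::complex) $ j * z $ j) = z $ k"
  by (simp add: axis_def if_distrib[of "\<lambda>c. c * _"] cong: if_cong)

lemma chart_matrix_vector_mult:
  "(chart_matrix k l A *v z) $ r =
    (case r of None \<Rightarrow> z $ k | Some None \<Rightarrow> z $ l | Some (Some i) \<Rightarrow> (A *v z) $ i)"
  by (simp add: chart_matrix_def matrix_vector_mult_def axis_mult_sum split: option.split)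

lemma chart_matrix_vector_mult_eq_0:
  "chart_matrix k l A *v z = 0 \<longleftrightarrow> A *v z = 0 \<and> z $ k = 0 \<and> z $ l = 0"
proof -
  have "chart_matrix k l A *v z = 0 \<longleftrightarrow> (\<forall>r. (chart_matrix k l A *v z) $ r = 0)"
    by (simp add: vec_eq_iff)
  also have "\<dots> \<longleftrightarrow> A *v z = 0 \<and> z $ k = 0 \<and> z $ l = 0"
    unfolding chart_matrix_vector_mult vec_eq_iff split_option_all by auto
  finally show ?thesis .
qed

text \<open>The right-hand side sees \<open>A\<close> only through its kernel and is symmetric in
  \<open>k\<close> and \<open>l\<close>. Thus lying in a chart is a property of the line,
  independent of the chosen equations and of the order of the two coordinates.\<close>

lemma chart_det_nonzero_iff:
  "chart_det k l A \<noteq> 0 \<longleftrightarrow> (\<forall>z. A *v z = 0 \<and> z $ k = 0 \<and> z $ l = 0 \<longrightarrow> z = 0)"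
  unfolding chart_det_def invertible_det_nz[symmetric] invertible_left_inverse
    matrix_left_invertible_ker chart_matrix_vector_mult_eq_0 ..

text \<open>Cramer's rule with the denominator cleared: \<open>chart_vec\<close> collects the
  numerators, so it stays polynomial in \<open>A\<close>.\<close>

lemma chart_vec_solves:
  assumes "chart_det k l A \<noteq> 0"
  shows "chart_matrix k l A *v chart_vec k l r A = chart_det k l A *s axis r 1"
proof -
  have "chart_matrix k l A *v ((1 / chart_det k l A) *s chart_vec k l r A) = axis r 1"
    unfolding cramer[OF assms[unfolded chart_det_def]]
    by (simp add: vec_eq_iff chart_vec_def chart_det_def)
  then show ?thesis
    using assms by (simp add: vector_scalar_commute vec_eq_iff field_simps)
qed

lemma chart_vec_line:
  assumes "chart_det k l A \<noteq> 0"
  shows "A *v chart_vec k l None A = 0" "chart_vec k l None A $ k = chart_det k l A"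
    "chart_vec k l None A $ l = 0" "A *v chart_vec k l (Some None) A = 0"
    "chart_vec k l (Some None) A $ k = 0" "chart_vec k l (Some None) A $ l = chart_det k l A"
proof -
  have eq: "(chart_matrix k l A *v chart_vec k l r A) $ i = (chart_det k l A *s axis r 1) $ i" for r i
    by (simp only: chart_vec_solves[OF assms])
  show "A *v chart_vec k l None A = 0" "A *v chart_vec k l (Some None) A = 0"
    using eq[of _ "Some (Some _)", unfolded chart_matrix_vector_mult]
    by (simp_all add: vec_eq_iff axis_def)
  show "chart_vec k l None A $ k = chart_det k l A" "chart_vec k l (Some None) A $ k = 0"
    using eq[of _ None, unfolded chart_matrix_vector_mult] by (simp_all add: axis_def)
  show "chart_vec k l None A $ l = 0" "chart_vec k l (Some None) A $ l = chart_det k l A"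
    using eq[of _ "Some None", unfolded chart_matrix_vector_mult] by (simp_all add: axis_def)
qed

lemma chart_expand:
  assumes "chart_det k l A \<noteq> 0" "A *v z = 0"
  shows "z = (z $ k / chart_det k l A) *s chart_vec k l None A +
    (z $ l / chart_det k l A) *s chart_vec k l (Some None) A" (is "z = ?w")
proof -
  have "A *v (z - ?w) = 0 \<and> (z - ?w) $ k = 0 \<and> (z - ?w) $ l = 0"
    using assms(1) by (simp add: matrix_vector_mult_diff_distrib matrix_vector_right_distrib
        vector_scalar_commute assms(2) chart_vec_line)
  with assms(1) have "z - ?w = 0" unfolding chart_det_nonzero_iff by blast
  then show ?thesis by simp
qed

lemma chart_right_inverse:
  assumes "chart_det k l A \<noteq> 0"
  shows "\<exists>R. A ** R = mat 1"
  unfolding matrix_right_invertible_surjective surj_def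
proof
  fix y
  have "surj ((*v) (chart_matrix k l A))"
    using assms unfolding chart_det_def invertible_det_nz[symmetric] invertible_right_inverse
      matrix_right_invertible_surjective .
  then obtain x where x: "chart_matrix k l A *v x =
      (\<chi> r. case r of None \<Rightarrow> 0 | Some None \<Rightarrow> 0 | Some (Some i) \<Rightarrow> y $ i)"
    by (metis surj_def)
  have "(A *v x) $ i = y $ i" for i
    using arg_cong[OF x, of "\<lambda>v. v $ Some (Some i)"] by (simp add: chart_matrix_vector_mult)
  then show "\<exists>x. y = A *v x" by (metis vec_eq_iff)
qed

lemma span_pair: "vec.span {p, q} = {a *s p + b *s q | a b. True}"
  by (auto simp: vec.span_breakdown_eq algebra_simps) (metis add.commute diff_add_cancel diff_eq_eq)+

text \<open>Gaussian elimination on a basis of the line: \<open>k\<close> is a pivot of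
  \<open>x\<close>, and \<open>l\<close> is a pivot of what is left of \<open>y\<close> once its
  coordinate \<open>k\<close> is cleared.\<close>

lemma chart_exists:
  assumes "line_of A \<in> lines"
  shows "\<exists>k l. chart_det k l A \<noteq> 0"
proof -
  have "vec.subspace (line_of A)" "vec.dim (line_of A) = 2"
    using assms by (auto simp: lines_def)
  then obtain b where b: "vec.independent b" "vec.span b = line_of A" "card b = 2"
    using vec.basis_exists[of "line_of A"] by (metis vec.span_subspace)
  then obtain x y where xy: "b = {x, y}" "x \<noteq> y" by (auto simp: card_2_iff)
  have x: "x \<noteq> 0" using b(1) xy vec.dependent_zero by auto
  have y: "y \<noteq> c *s x" for c
    using b(1) xy unfolding vec.dependent_def by (auto simp: vec.span_singleton insert_Diff_if)
  obtain k where k: "x $ k \<noteq> 0" using x by (auto simp: vec_eq_iff)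
  define y' where "y' = y - (y $ k / x $ k) *s x"
  have "y' \<noteq> 0" using y[of "y $ k / x $ k"] by (auto simp: y'_def)
  then obtain l where l: "y' $ l \<noteq> 0" by (auto simp: vec_eq_iff)
  have "z = 0" if z: "A *v z = 0" "z $ k = 0" "z $ l = 0" for z
  proof -
    have "z \<in> vec.span {x, y}" using z(1) b(2) xy by (simp add: line_of_def)
    then obtain s t where st: "z = s *s x + t *s y" by (auto simp: span_pair)
    then have zs: "z = (s + t * (y $ k / x $ k)) *s x + t *s y'"
      by (simp add: y'_def vec_eq_iff algebra_simps)
    have "s + t * (y $ k / x $ k) = 0"
      using arg_cong[OF st, of "\<lambda>v. v $ k"] z(2) k by (simp add: field_simps)
    moreover from this have "t = 0"
      using arg_cong[OF zs, of "\<lambda>v. v $ l"] z(3) l by simp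
    ultimately show ?thesis using zs by simp
  qed
  then show ?thesis unfolding chart_det_nonzero_iff by blast
qed

section \<open>Open conditions on the lines of the family\<close>

lemma openin_grass:
  assumes "r \<in> regular_functions"
  shows "openin grass_zariski {line_of A | A. line_of A \<in> lines \<and> r A \<noteq> 0}"
proof -
  obtain Q where "\<And>A. r A = eval_at Q (entries A)"
    using assms by (auto simp: regular_functions_def)
  then show ?thesis
    unfolding grass_zariski_def by (intro topology_generated_by_Basis) auto
qed

text \<open>Irreducibility of \<open>S\<close> gives a line common to both open sets, but
  \<open>r\<close> and \<open>s\<close> may be nonzero at two different systems \<open>M\<close> and
  \<open>N\<close> of its equations. These are joined by the affine line
  \<open>M + t (N - M)\<close>, on which a general \<open>t\<close> serves both.\<close>

lemma frames_irreducible: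
  assumes S: "S \<subseteq> lines" "irreducible_space (subtopology grass_zariski S)"
    and r: "r \<in> regular_functions" and s: "s \<in> regular_functions"
    and A: "A1 \<in> frames S" "r A1 \<noteq> 0" "A2 \<in> frames S" "s A2 \<noteq> 0"
  shows "\<exists>A\<in>frames S. r A * s A \<noteq> 0"
proof -
  define D where "D r = {line_of A | A. line_of A \<in> lines \<and> r A \<noteq> 0} \<inter> S"
    for r :: "'a eqs \<Rightarrow> complex"
  have "openin (subtopology grass_zariski S) (D r)" "openin (subtopology grass_zariski S) (D s)"
    unfolding D_def by (intro openin_subtopology_Int openin_grass r s)+
  moreover have "D r \<noteq> {}" "D s \<noteq> {}"
    using A S(1) by (auto simp: D_def frames_def)
  ultimately have "D r \<inter> D s \<noteq> {}"
    using S(2) unfolding irreducible_space_def by blast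
  then obtain M N where MN: "line_of M \<in> S" "line_of N = line_of M" "r M \<noteq> 0" "s N \<noteq> 0"
    by (auto simp: D_def)
  obtain k l where kl: "chart_det k l M \<noteq> 0"
    using chart_exists MN(1) S(1) by blast
  obtain Q1 Q2 Q3 where Q: "\<And>A. r A = eval_at Q1 (entries A)" "\<And>A. s A = eval_at Q2 (entries A)"
    "\<And>A. chart_det k l A = eval_at Q3 (entries A)"
    using r s chart_det_regular[of k l] by (auto simp: regular_functions_def)
  define P where "P Q = along Q (entries M) (entries (N - M))" for Q
  have P: "poly (P Q) t = eval_at Q (entries (shift M (N - M) t))" for Q t
    by (simp add: P_def poly_along entries_shift)
  have "shift M (N - M) 1 = N" by (simp add: shift_def vec_eq_iff)
  with P[of _ 0] P[of _ 1] have "poly (P Q1) 0 \<noteq> 0" "poly (P Q2) 1 \<noteq> 0" "poly (P Q3) 0 \<noteq> 0"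
    using MN kl Q by simp_all
  then have "P Q1 * P Q2 * P Q3 \<noteq> 0" by auto
  then obtain t where t: "poly (P Q1 * P Q2 * P Q3) t \<noteq> 0"
    using poly_all_0_iff_0 by blast
  define A where "A = shift M (N - M) t"
  have nz: "r A \<noteq> 0" "s A \<noteq> 0" "chart_det k l A \<noteq> 0"
    using t by (auto simp: Q P A_def)
  have sub: "A *v x = 0" if "M *v x = 0" for x
  proof -
    have "N *v x = 0" using that MN(2) by (auto simp: line_of_def)
    with that show ?thesis
      by (simp add: A_def shift_vector_mult matrix_vector_mult_diff_rdistrib)
  qed
  \<comment> \<open>The kernel does not grow: \<open>?y\<close> is the vector of the line with the
    same coordinates \<open>k\<close> and \<open>l\<close> as \<open>x\<close>, and
    \<open>chart_det k l A \<noteq> 0\<close> forces \<open>x = ?y\<close>. This is why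
    \<open>Q3\<close> was kept nonzero.\<close>
  have "M *v x = 0" if x: "A *v x = 0" for x
  proof -
    let ?y = "(x $ k / chart_det k l M) *s chart_vec k l None M +
      (x $ l / chart_det k l M) *s chart_vec k l (Some None) M"
    have y: "M *v ?y = 0"
      using kl by (simp add: matrix_vector_right_distrib vector_scalar_commute chart_vec_line)
    have "A *v (x - ?y) = 0 \<and> (x - ?y) $ k = 0 \<and> (x - ?y) $ l = 0"
      using kl sub[OF y] x by (simp add: matrix_vector_mult_diff_distrib chart_vec_line)
    with nz(3) have "x - ?y = 0" unfolding chart_det_nonzero_iff by blast
    with y show ?thesis by simp
  qed
  with sub have "line_of A = line_of M" by (auto simp: line_of_def)
  with nz MN(1) show ?thesis by (intro bexI[of _ A]) (auto simp: frames_def)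
qed

section \<open>Focal minors\<close>

lemma poly_det: "poly (det M) t = det (\<chi> i j. poly (M $ i $ j) t)"
  for M :: "'a::comm_ring_1 poly ^ 'n ^ 'n"
  by (simp add: det_def poly_sum poly_prod sign_def)

text \<open>
  Replacing the \<open>k\<close>-th row of the pencil \<open>M\<^sub>0 + t M\<^sub>1\<close> by its combination with coefficients
  \<open>\<phi>\<close> multiplies the determinant by \<open>\<phi>\<^sub>k\<close> and makes that row \<open>t\<close> times \<open>\<phi> M\<^sub>1\<close>.
\<close>

lemma det_pencil:
  fixes M0 M1 :: "complex ^ 'n ^ 'n" and \<phi> :: "complex ^ 'n"
  assumes "\<phi> \<noteq> 0" and \<phi>M0: "\<And>j. (\<Sum>i\<in>UNIV. \<phi> $ i * M0 $ i $ j) = 0"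
  defines "g \<equiv> det (\<chi> i j. [:M0 $ i $ j, M1 $ i $ j:])"
  shows "poly g 0 = 0"
    and "(\<And>\<psi>. M0 *v \<psi> = 0 \<Longrightarrow> (\<Sum>i\<in>UNIV. \<phi> $ i * (M1 *v \<psi>) $ i) = 0) \<Longrightarrow> [:0, 1:] ^ 2 dvd g"
proof -
  obtain k where k: "\<phi> $ k \<noteq> 0" using \<open>\<phi> \<noteq> 0\<close> by (auto simp: vec_eq_iff)
  define w where "w = (\<chi> j. \<Sum>i\<in>UNIV. \<phi> $ i * M1 $ i $ j)"
  define K where "K = det (\<chi> i j. if i = k then [:w $ j:] else [:M0 $ i $ j, M1 $ i $ j:])"
  have "poly (smult (\<phi> $ k) g) t = poly ([:0, 1:] * K) t" for t
  proof -
    define M where "M = (\<chi> i j. M0 $ i $ j + t * M1 $ i $ j)"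
    have "poly (smult (\<phi> $ k) g) t = \<phi> $ k * det M"
      by (simp add: g_def poly_det M_def)
    also have "\<dots> = det (\<chi> i. if i = k then \<Sum>i\<in>UNIV. \<phi> $ i *s row i M else row i M)"
      by (rule cramer_lemma_transpose[symmetric])
    also have "(\<Sum>i\<in>UNIV. \<phi> $ i *s row i M) = t *s w"
      by (simp add: vec_eq_iff row_def M_def w_def distrib_left sum.distrib \<phi>M0 sum_distrib_left mult_ac)
    also have "det (\<chi> i. if i = k then t *s w else row i M) = t * det (\<chi> i. if i = k then w else row i M)"
      by (rule det_row_mul)
    also have "(\<chi> i. if i = k then w else row i M) =
        (\<chi> i j. poly (if i = k then [:w $ j:] else [:M0 $ i $ j, M1 $ i $ j:]) t)"
      by (simp add: vec_eq_iff row_def M_def)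
    finally show ?thesis by (simp add: K_def poly_det)
  qed
  then have eq: "smult (\<phi> $ k) g = [:0, 1:] * K"
    using poly_eq_poly_eq_iff by blast
  show "poly g 0 = 0" using arg_cong[OF eq, of "\<lambda>p. poly p 0"] k by simp
  assume M1: "\<And>\<psi>. M0 *v \<psi> = 0 \<Longrightarrow> (\<Sum>i\<in>UNIV. \<phi> $ i * (M1 *v \<psi>) $ i) = 0"
  define N where "N = (\<chi> i j. if i = k then w $ j else M0 $ i $ j)"
  \<comment> \<open>If \<open>N\<close> were invertible, a \<open>\<psi>\<close> with
    \<open>N *v \<psi> = axis k 1\<close> would lie in the kernel of \<open>M0\<close>: the rows
    other than \<open>k\<close> are shared, and row \<open>k\<close> follows from the relation
    \<open>\<phi>\<close>. Then \<open>\<phi> M\<^sub>1 \<psi>\<close> would be both 0 and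
    1.\<close>
  have "det N = 0"
  proof (rule ccontr)
    assume "det N \<noteq> 0"
    then have "surj ((*v) N)"
      unfolding invertible_det_nz[symmetric] invertible_right_inverse
        matrix_right_invertible_surjective .
    then obtain \<psi> where \<psi>: "N *v \<psi> = axis k 1" by (metis surj_def)
    have other: "(M0 *v \<psi>) $ i = 0" if "i \<noteq> k" for i
      using arg_cong[OF \<psi>, of "\<lambda>v. v $ i"] that
      by (simp add: N_def matrix_vector_mult_def axis_def)
    have "(\<Sum>i\<in>UNIV. \<phi> $ i * (M0 *v \<psi>) $ i) = (\<Sum>j\<in>UNIV. (\<Sum>i\<in>UNIV. \<phi> $ i * M0 $ i $ j) * \<psi> $ j)"
      unfolding matrix_vector_mult_def vec_lambda_beta sum_distrib_left sum_distrib_right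
      by (subst sum.swap) (simp add: mult.assoc)
    then have "(\<Sum>i\<in>UNIV. \<phi> $ i * (M0 *v \<psi>) $ i) = 0" by (simp add: \<phi>M0)
    then have "\<phi> $ k * (M0 *v \<psi>) $ k = 0"
      by (subst (asm) sum.remove[of UNIV k]) (simp_all add: other)
    with k other have "M0 *v \<psi> = 0" by (auto simp: vec_eq_iff) metis
    from M1[OF this] have "(\<Sum>i\<in>UNIV. \<phi> $ i * (M1 *v \<psi>) $ i) = 0" .
    moreover have "(\<Sum>i\<in>UNIV. \<phi> $ i * (M1 *v \<psi>) $ i) = (N *v \<psi>) $ k"
      unfolding N_def w_def matrix_vector_mult_def vec_lambda_beta sum_distrib_left
      by (subst sum.swap) (simp add: mult.assoc sum_distrib_right)
    ultimately show False by (simp add: \<psi>)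
  qed
  moreover have "poly K 0 = det N"
    unfolding K_def poly_det N_def by (intro arg_cong[of _ _ det]) (simp add: vec_eq_iff)
  ultimately have "[:0, 1:] dvd K" by (simp only: X_dvd_iff)
  then have "[:0, 1:] ^ 2 dvd smult (\<phi> $ k) g"
    unfolding eq power2_eq_square by (intro mult_dvd_mono dvd_refl)
  with k show "[:0, 1:] ^ 2 dvd g" by (metis dvd_smult_cancel)
qed

section \<open>Change of equations and tangent vectors of the frame bundle\<close>

lemma line_of_mult:
  assumes "G' ** G = mat 1"
  shows "line_of (G ** A) = line_of A"
proof -
  have "A *v x = 0" if "G *v (A *v x) = 0" for x
  proof -
    have "A *v x = G' *v (G *v (A *v x))" by (simp add: matrix_vector_mul_assoc matrix_mul_assoc assms)
    with that show ?thesis by simp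
  qed
  then show ?thesis
    by (auto simp: line_of_def matrix_vector_mul_assoc[symmetric])
qed

text \<open>The transition matrix is \<open>A ** R'\<close> with \<open>R'\<close> a right inverse
  of \<open>A'\<close>: the vector \<open>R' A' x - x\<close> is in the kernel of \<open>A'\<close>,
  hence in that of \<open>A\<close>.\<close>

lemma same_line_transition:
  assumes "line_of A = line_of A'" "chart_det k l A \<noteq> 0"
  shows "\<exists>G G'. G ** G' = mat 1 \<and> G' ** G = mat 1 \<and> A = G ** A'"
proof -
  have ker: "A *v x = 0 \<longleftrightarrow> A' *v x = 0" for x
    using assms(1) by (auto simp: line_of_def)
  then have "chart_det k l A' \<noteq> 0"
    using assms(2) by (simp add: chart_det_nonzero_iff)
  then obtain R R' where R: "A ** R = mat 1" "A' ** R' = mat 1"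
    using chart_right_inverse assms(2) by blast
  have eq: "A ** R' ** A' = A"
    unfolding matrix_eq
  proof
    fix x
    have "A' *v (R' *v (A' *v x) - x) = 0"
      by (simp add: matrix_vector_mult_diff_distrib matrix_vector_mul_assoc R matrix_mul_assoc)
    then have "A *v (R' *v (A' *v x) - x) = 0" by (simp only: ker)
    then show "A ** R' ** A' *v x = A *v x"
      by (simp add: matrix_vector_mult_diff_distrib matrix_vector_mul_assoc matrix_mul_assoc)
  qed
  have "(A ** R') ** (A' ** R) = mat 1"
    using arg_cong[OF eq, of "\<lambda>M. M ** R"] by (simp add: matrix_mul_assoc R)
  then show ?thesis using matrix_left_right_inverse eq by metis
qed

text \<open>Left multiplication by \<open>G'\<close> maps \<open>frames S\<close> to itself and is
  linear in the entries, so it pulls equations of \<open>frames S\<close> back to equations of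
  \<open>frames S\<close>.\<close>

lemma frame_tangent_mult:
  assumes G: "G ** G' = mat 1" and B: "B \<in> frame_tangent S A"
  shows "G' ** B \<in> frame_tangent S (G' ** A)"
  unfolding frame_tangent_def
proof (intro CollectI allI impI)
  fix Q assume Q: "\<forall>A'\<in>frames S. eval_at Q (entries A') = 0"
  have "(\<lambda>A. entries (G' ** A) i) \<in> regular_functions" for i
    unfolding entries_def matrix_matrix_mult_def
    by (cases i) (auto intro!: subalgebra_sum subalgebra_mult subalgebra_const entry_regular
        subalgebra_regular)
  then have "(\<lambda>A. eval_at Q (entries (G' ** A))) \<in> regular_functions"
    by (intro subalgebra_eval_at subalgebra_regular)
  then obtain Q' where Q': "\<And>A. eval_at Q (entries (G' ** A)) = eval_at Q' (entries A)"
    by (auto simp: regular_functions_def)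
  have "eval_at Q' (entries A') = 0" if "A' \<in> frames S" for A'
    using Q that line_of_mult[OF G, of A'] by (simp add: Q'[symmetric] frames_def)
  with B have "[:0, 1:] ^ 2 dvd along Q' (entries A) (entries B)"
    by (auto simp: frame_tangent_def)
  moreover have "along Q (entries (G' ** A)) (entries (G' ** B)) = along Q' (entries A) (entries B)"
  proof -
    have "(\<lambda>i. entries (G' ** A) i + t * entries (G' ** B) i) = entries (G' ** shift A B t)" for t
      by (auto simp: entries_def shift_def matrix_matrix_mult_def distrib_left sum.distrib
          sum_distrib_left mult_ac)
    then have "poly (along Q (entries (G' ** A)) (entries (G' ** B))) t =
        poly (along Q' (entries A) (entries B)) t" for t
      unfolding poly_along by (simp add: Q' entries_shift)
    then show ?thesis using poly_eq_poly_eq_iff by blast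
  qed
  ultimately show "[:0, 1:] ^ 2 dvd along Q (entries (G' ** A)) (entries (G' ** B))" by simp
qed

text \<open>Tangency is linear in \<open>B\<close> by \<open>frame_tangent_iff\<close>. This turns a
  vector \<open>\<psi>\<close> in the kernel of the focal matrix at \<open>p\<close> into a single
  tangent vector that annihilates \<open>p\<close>.\<close>

lemma frame_tangent_combination:
  assumes "\<And>j. B j \<in> frame_tangent S A"
  shows "(\<chi> r s. \<Sum>j\<in>UNIV. \<psi> $ j * B j $ r $ s) \<in> frame_tangent S A"
  unfolding frame_tangent_iff
proof (intro allI impI conjI)
  fix Q assume "\<forall>A'\<in>frames S. eval_at Q (entries A') = 0"
  then have Q: "eval_at Q (entries A) = 0"
    "(\<Sum>i\<in>UNIV. eval_at (partial i Q) (entries A) * entries (B j) i) = 0" for j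
    using assms by (auto simp: frame_tangent_iff)
  show "eval_at Q (entries A) = 0" by (rule Q)
  have "entries (\<chi> r s. \<Sum>j\<in>UNIV. \<psi> $ j * B j $ r $ s) i = (\<Sum>j\<in>UNIV. \<psi> $ j * entries (B j) i)" for i
    by (cases i) (simp add: entries_def)
  then have "(\<Sum>i\<in>UNIV. eval_at (partial i Q) (entries A) *
      entries (\<chi> r s. \<Sum>j\<in>UNIV. \<psi> $ j * B j $ r $ s) i) =
    (\<Sum>j\<in>UNIV. \<psi> $ j * (\<Sum>i\<in>UNIV. eval_at (partial i Q) (entries A) * entries (B j) i))"
    unfolding sum_distrib_left by (simp add: sum_distrib_left, subst sum.swap) (simp add: mult_ac)
  then show "(\<Sum>i\<in>UNIV. eval_at (partial i Q) (entries A) *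
      entries (\<chi> r s. \<Sum>j\<in>UNIV. \<psi> $ j * B j $ r $ s) i) = 0"
    by (simp add: Q)
qed

text \<open>This is the derivative of \<open>A *v chart_vec k l r A = 0\<close>. That equation is
  available where \<open>chart_det\<close> is nonzero; multiplied by \<open>chart_det\<close> it
  holds for all matrices, and the Leibniz rule then removes the factor.\<close>

lemma chart_vec_variation:
  assumes "chart_det k l A \<noteq> 0" and r: "r = None \<or> r = Some None"
  shows "B *v chart_vec k l r A + A *v (\<chi> i. tangent_derivative A B (\<lambda>y. chart_vec k l r y $ i)) = 0"
  unfolding vec_eq_iff
proof
  fix j
  define s where "s y = (\<Sum>i\<in>UNIV. y $ j $ i * chart_vec k l r y $ i)" for y
  have s: "s \<in> regular_functions"
    unfolding s_def
    by (intro subalgebra_sum subalgebra_mult entry_regular chart_vec_regular subalgebra_regular)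
  have zero: "chart_det k l y * s y = 0" for y
  proof (cases "chart_det k l y = 0")
    case False
    then have "(y *v chart_vec k l r y) $ j = 0" using r chart_vec_line[OF False] by auto
    then show ?thesis by (simp add: s_def matrix_vector_mult_def)
  qed simp
  have "0 = tangent_derivative A B (\<lambda>y. chart_det k l y * s y)"
    unfolding zero by (simp add: tangent_derivative_def)
  also have "\<dots> = chart_det k l A * tangent_derivative A B s"
    using zero[of A] assms(1) by (simp add: tangent_derivative_mult chart_det_regular s)
  finally have "tangent_derivative A B s = 0" using assms(1) by simp
  moreover have "tangent_derivative A B s =
      (\<Sum>i\<in>UNIV. A $ j $ i * tangent_derivative A B (\<lambda>y. chart_vec k l r y $ i) + B $ j $ i * chart_vec k l r A $ i)"
    unfolding s_def
    by (simp add: tangent_derivative_sum tangent_derivative_mult tangent_derivative_entry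
        subalgebra_mult[OF subalgebra_regular] entry_regular chart_vec_regular)
  ultimately show "(B *v chart_vec k l r A +
      A *v (\<chi> i. tangent_derivative A B (\<lambda>y. chart_vec k l r y $ i))) $ j = 0 $ j"
    by (simp add: matrix_vector_mult_def sum.distrib add.commute)
qed

lemma line_coords_scale:
  assumes "line_coords L P p q" "c \<noteq> 0"
  shows "line_coords L P (c *s p) q"
proof -
  have p: "p = (1 / c) *s (c *s p)" using assms(2) by (simp add: vec_eq_iff)
  have cp: "c *s p \<in> vec.span {p}" "p \<in> vec.span {c *s p}"
    using p by (metis insertI1 vec.span_base vec.span_scale)+
  then have "vec.span {c *s p} = vec.span {p}"
    by (simp add: vec.span_eq)
  moreover have "vec.span {c *s p, q} = vec.span {p, q}"
    unfolding vec.span_eq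
    using cp vec.span_mono[of "{p}" "{p, q}"] vec.span_mono[of "{c *s p}" "{c *s p, q}"]
    by (auto intro: vec.span_base)
  ultimately show ?thesis using assms(1) by (simp add: line_coords_def)
qed

text \<open>\<open>P0\<close> is the representative of \<open>P\<close> whose coordinate
  \<open>k\<close> equals \<open>chart_det k l A\<close>, and \<open>p $ l / p $ k\<close> is the
  value at which the chart parametrisation of the line passes through \<open>P\<close>.\<close>

lemma line_coords_chart:
  assumes lc: "line_coords (line_of A) P p q" and kl: "chart_det k l A \<noteq> 0" and pk: "p $ k \<noteq> 0"
  defines "P0 \<equiv> chart_vec k l None A + (p $ l / p $ k) *s chart_vec k l (Some None) A"
  shows "p = (p $ k / chart_det k l A) *s P0" "line_coords (line_of A) P P0 (chart_vec k l (Some None) A)"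
proof -
  let ?p = "chart_vec k l None A" and ?q = "chart_vec k l (Some None) A"
  have "p \<in> line_of A" using lc by (auto simp: line_coords_def intro: vec.span_base)
  then have "A *v p = 0" by (simp add: line_of_def)
  have "(p $ k / chart_det k l A) *s P0 = (p $ k / chart_det k l A) *s ?p + (p $ l / chart_det k l A) *s ?q"
    using pk kl by (simp add: P0_def vec_eq_iff field_simps)
  with chart_expand[OF kl \<open>A *v p = 0\<close>] show p: "p = (p $ k / chart_det k l A) *s P0"
    by (rule trans[OF _ sym])
  have "P0 = (chart_det k l A / p $ k) *s p"
    using arg_cong[OF p, of "(*s) (chart_det k l A / p $ k)"] pk kl by simp
  then have "P = vec.span {P0}"
    using line_coords_scale[OF lc, of "chart_det k l A / p $ k"] pk kl by (simp add: line_coords_def)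
  moreover have "vec.span {P0, ?q} = line_of A"
  proof
    have "A *v P0 = 0" "A *v ?q = 0"
      using kl by (simp_all add: P0_def matrix_vector_right_distrib vector_scalar_commute chart_vec_line)
    then show "vec.span {P0, ?q} \<subseteq> line_of A"
      by (auto simp: span_pair line_of_def matrix_vector_right_distrib vector_scalar_commute)
    show "line_of A \<subseteq> vec.span {P0, ?q}"
    proof
      fix z assume "z \<in> line_of A"
      then obtain a b where "z = a *s ?p + b *s ?q"
        using chart_expand[OF kl] by (auto simp: line_of_def)
      then have "z = a *s P0 + (b - a * (p $ l / p $ k)) *s ?q"
        by (simp add: P0_def vec_eq_iff algebra_simps)
      then show "z \<in> vec.span {P0, ?q}" unfolding span_pair by blast
    qed
  qed
  ultimately show "line_coords (line_of A) P P0 ?q" by (simp add: line_coords_def)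
qed

text \<open>This is \<open>f\<^sub>L\<close> in a parameter common to all lines of the chart. The
  point with \<open>x\<^sub>k = 0\<close> sits at infinity and is missed, which is why the charts
  \<open>(k, l)\<close> and \<open>(l, k)\<close> are later used together.\<close>

definition chart_family ::
    "('n::finite) option option mpoly \<Rightarrow> 'n option option \<Rightarrow> 'n option option \<Rightarrow> 'n eqs \<Rightarrow> complex poly" where
  "chart_family G k l y = along G (($) (chart_vec k l None y)) (($) (chart_vec k l (Some None) y))"

text \<open>The root \<open>a\<close> stays fixed while the line moves. This is the conclusion of
  \<open>derivation_vanishes_at_double_root\<close> for the tangent vectors of
  \<open>frames S\<close>.\<close>

definition double_root_stable ::
    "('n::finite) hvec set set \<Rightarrow> ('n eqs \<Rightarrow> complex poly) \<Rightarrow> 'n eqs \<Rightarrow> bool" where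
  "double_root_stable S f A \<longleftrightarrow> (\<forall>a. poly (f A) a = 0 \<longrightarrow> poly (pderiv (f A)) a = 0 \<longrightarrow>
     (\<forall>B\<in>frame_tangent S A. tangent_derivative A B (\<lambda>y. poly (f y) a) = 0))"

lemma poly_family_chart: "poly_family regular_functions (chart_family G k l)"
  unfolding chart_family_def[abs_def]
  by (intro poly_family_along chart_vec_regular subalgebra_regular)

lemma double_root_stable_generic:
  assumes "poly_family regular_functions f" "frames S \<noteq> {}"
  shows "\<exists>r\<in>regular_functions. (\<exists>A\<in>frames S. r A \<noteq> 0) \<and>
    (\<forall>A\<in>frames S. r A \<noteq> 0 \<longrightarrow> double_root_stable S f A)"
proof -
  have "derivation_at regular_functions (frames S) A (tangent_derivative A B)"
    if "B \<in> frame_tangent S A" for A B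
    using that unfolding derivation_at_def
    by (auto intro: tangent_derivative_mult tangent_derivative_cong)
  moreover obtain r where "r \<in> regular_functions" "(\<exists>A\<in>frames S. r A \<noteq> 0) \<and>
    (\<forall>A\<in>frames S. r A \<noteq> 0 \<longrightarrow> (\<forall>a \<delta>. poly (f A) a = 0 \<longrightarrow> poly (pderiv (f A)) a = 0 \<longrightarrow>
      derivation_at regular_functions (frames S) A \<delta> \<longrightarrow> \<delta> (\<lambda>y. poly (f y) a) = 0))"
    using derivation_vanishes_at_double_root[OF subalgebra_regular assms] by (rule bexE)
  ultimately show ?thesis
    unfolding double_root_stable_def by (intro bexI[of _ r]) auto
qed

text \<open>
  The contact point moves with the line along every tangent vector \<open>B\<close>, and does so inside the
  hypersurface, so \<open>B p\<close> lies in the image of the tangent hyperplane under \<open>A\<close>; the linear form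
  \<open>\<phi>\<close> is the equation of that image. If \<open>B p = 0\<close>, the point moves along the line itself, and
  contact of order two keeps the tangent direction in the tangent hyperplane to first order.
\<close>

lemma focal_form:
  assumes kl: "chart_det k l A \<noteq> 0"
    and stable: "double_root_stable S (chart_family G k l) A"
      "double_root_stable S (\<lambda>y. pderiv (chart_family G k l y)) A"
    and lc: "line_coords (line_of A) P p q" and pk: "p $ k \<noteq> 0"
    and G: "homogeneous d G" "eval_at (partial i0 G) (($) p) \<noteq> 0"
    and contact: "\<And>p q. line_coords (line_of A) P p q \<Longrightarrow> [:0, 1:] ^ 2 dvd along G (($) p) (($) q)"
  shows "\<exists>\<phi>. \<phi> \<noteq> 0 \<and> (\<forall>B\<in>frame_tangent S A. (\<Sum>i\<in>UNIV. \<phi> $ i * (B *v p) $ i) = 0) \<and>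
    ((\<forall>p q. line_coords (line_of A) P p q \<longrightarrow> [:0, 1:] ^ 3 dvd along G (($) p) (($) q)) \<longrightarrow>
      (\<forall>B\<in>frame_tangent S A. B *v p = 0 \<longrightarrow> (\<Sum>i\<in>UNIV. \<phi> $ i * (B *v q) $ i) = 0))"
proof -
  define a where "a = p $ l / p $ k"
  define c where "c = p $ k / chart_det k l A"
  define Q0 where "Q0 = chart_vec k l (Some None) A"
  define P0 where "P0 = chart_vec k l None A + a *s Q0"
  have p: "p = c *s P0" and lc0: "line_coords (line_of A) P P0 Q0"
    using line_coords_chart[OF lc kl pk] unfolding a_def c_def P0_def Q0_def by simp_all
  have c: "c \<noteq> 0" using pk kl by (simp add: c_def)
  have ker: "A *v x = 0 \<longleftrightarrow> (\<exists>s t. x = s *s P0 + t *s Q0)" for x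
  proof -
    have "x \<in> line_of A \<longleftrightarrow> x \<in> vec.span {P0, Q0}" using lc0 by (simp add: line_coords_def)
    then show ?thesis by (auto simp: line_of_def span_pair)
  qed
  define g where "g i = eval_at (partial i G) (($) P0)" for i
  define dG where "dG v = (\<Sum>i\<in>UNIV. g i * v $ i)" for v
  have dG_add: "dG (x + y) = dG x + dG y" and dG_scale: "dG (s *s x) = s * dG x" for x y s
    by (simp_all add: dG_def distrib_left sum.distrib sum_distrib_left mult_ac)
  \<comment> \<open>Contact is assumed for every representative of \<open>P\<close>, hence for all
    nonzero multiples of \<open>P0\<close>. Differentiating in \<open>s\<close> gives the Euler
    relations \<open>dG_P0\<close> and \<open>H_P0\<close>.\<close>
  have vanish: "eval_at G (\<lambda>i. s * P0 $ i) = 0"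
    "s \<noteq> 0 \<Longrightarrow> (\<Sum>i\<in>UNIV. eval_at (partial i G) (\<lambda>i. s * P0 $ i) * Q0 $ i) = 0" for s
  proof -
    have *: "eval_at G (\<lambda>i. s * P0 $ i) = 0 \<and>
        (\<Sum>i\<in>UNIV. eval_at (partial i G) (\<lambda>i. s * P0 $ i) * Q0 $ i) = 0" if "s \<noteq> 0" for s
      using contact[OF line_coords_scale[OF lc0 that]]
      unfolding X_square_dvd_iff poly_along poly_pderiv_along by simp
    show "s \<noteq> 0 \<Longrightarrow> (\<Sum>i\<in>UNIV. eval_at (partial i G) (\<lambda>i. s * P0 $ i) * Q0 $ i) = 0"
      using * by blast
    have "eval_at G (($) P0) = 0" using *[of 1] by simp
    then show "eval_at G (\<lambda>i. s * P0 $ i) = 0" by (simp add: eval_at_homogeneous[OF G(1)])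
  qed
  have dG_Q0: "dG Q0 = 0" using vanish(2)[of 1] by (simp add: dG_def g_def)
  have dG_P0: "dG P0 = 0"
  proof -
    have "poly (along G (($) P0) (($) P0)) t = 0" for t
      using vanish(1)[of "1 + t"] by (simp add: poly_along algebra_simps)
    then have "along G (($) P0) (($) P0) = 0" using poly_all_0_iff_0 by blast
    then show ?thesis
      using poly_pderiv_along[of G "($) P0" "($) P0" 0] by (simp add: dG_def g_def)
  qed
  have dG_ker: "dG x = 0" if "A *v x = 0" for x
    using that unfolding ker by (auto simp: dG_add dG_scale dG_P0 dG_Q0)
  \<comment> \<open>Since \<open>dG\<close> vanishes on the line, it factors through
    \<open>A\<close>. The factor is \<open>\<phi>\<close>, the equation of the tangent hyperplane in
    the normal space; the right inverse \<open>R\<close> serves to write it down.\<close>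
  obtain R where R: "A ** R = mat 1" using chart_right_inverse[OF kl] by blast
  define \<phi> where "\<phi> = (\<chi> j. \<Sum>i\<in>UNIV. g i * R $ i $ j)"
  have \<phi>_R: "(\<Sum>j\<in>UNIV. \<phi> $ j * y $ j) = dG (R *v y)" for y
    unfolding \<phi>_def dG_def matrix_vector_mult_def vec_lambda_beta sum_distrib_left sum_distrib_right
    by (subst sum.swap) (simp add: mult.assoc)
  have \<phi>_A: "(\<Sum>j\<in>UNIV. \<phi> $ j * (A *v x) $ j) = dG x" for x
  proof -
    have "A *v (R *v (A *v x) + (-1) *s x) = 0"
      by (simp add: matrix_vector_mult_diff_distrib matrix_vector_mul_assoc matrix_mul_assoc R)
    from dG_ker[OF this] show ?thesis by (simp only: \<phi>_R dG_add dG_scale) simp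
  qed
  have "\<phi> \<noteq> 0"
  proof
    assume "\<phi> = 0"
    then have "dG (axis i0 1) = 0" using \<phi>_A[of "axis i0 1"] by simp
    then have "g i0 = 0"
      by (simp add: dG_def axis_def if_distrib[of "\<lambda>x. _ * x"] cong: if_cong)
    moreover have "eval_at (partial i0 G) (($) p) = c ^ (d - 1) * g i0"
    proof -
      have "($) p = (\<lambda>i. c * P0 $ i)" unfolding p by auto
      then show ?thesis
        using eval_at_homogeneous[OF homogeneous_partial[OF G(1)]] by (simp add: g_def)
    qed
    ultimately show False using G(2) by simp
  qed
  have poly_f: "poly (chart_family G k l y) t =
      eval_at G (\<lambda>i. chart_vec k l None y $ i + t * chart_vec k l (Some None) y $ i)"
    and poly_f': "poly (pderiv (chart_family G k l y)) t =
      (\<Sum>i\<in>UNIV. eval_at (partial i G) (\<lambda>i. chart_vec k l None y $ i + t * chart_vec k l (Some None) y $ i)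
        * chart_vec k l (Some None) y $ i)" for y t
    by (simp_all add: chart_family_def poly_along poly_pderiv_along)
  have P0_fun: "(\<lambda>i. chart_vec k l None A $ i + a * chart_vec k l (Some None) A $ i) = ($) P0"
    by (auto simp: P0_def Q0_def)
  have f0: "poly (chart_family G k l A) a = 0"
    using vanish(1)[of 1] by (simp add: poly_f P0_fun)
  have f1: "poly (pderiv (chart_family G k l A)) a = 0"
    using dG_Q0 by (simp add: poly_f' P0_fun dG_def g_def Q0_def)
  note reg = chart_vec_regular subalgebra_regular subalgebra_const[OF subalgebra_regular]
    subalgebra_add[OF subalgebra_regular] subalgebra_mult[OF subalgebra_regular]
  \<comment> \<open>Velocities of the two chart points when the equations move along
    \<open>B\<close>; \<open>v B\<close> is the velocity of the point of fixed parameter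
    \<open>a\<close>, which starts at \<open>P0\<close>.\<close>
  define vp vq v where "vp B = (\<chi> i. tangent_derivative A B (\<lambda>y. chart_vec k l None y $ i))"
    and "vq B = (\<chi> i. tangent_derivative A B (\<lambda>y. chart_vec k l (Some None) y $ i))"
    and "v B = vp B + a *s vq B" for B
  have v: "tangent_derivative A B (\<lambda>y. chart_vec k l None y $ i + a * chart_vec k l (Some None) y $ i)
      = v B $ i" for B i
    using tangent_derivative_mult[of "\<lambda>y. a" "\<lambda>y. chart_vec k l (Some None) y $ i" A B]
    by (simp add: v_def vp_def vq_def tangent_derivative_add reg)
       (simp add: tangent_derivative_def)
  have BQ0: "B *v Q0 + A *v vq B = 0" for B
    using chart_vec_variation[OF kl, of "Some None" B] by (simp add: Q0_def vq_def)
  have BP0: "B *v P0 + A *v v B = 0" for B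
  proof -
    have "B *v chart_vec k l None A + A *v vp B = 0"
      using chart_vec_variation[OF kl, of None B] by (simp add: vp_def)
    moreover have "B *v P0 + A *v v B = (B *v chart_vec k l None A + A *v vp B) + a *s (B *v Q0 + A *v vq B)"
      by (simp add: P0_def v_def matrix_vector_right_distrib vector_scalar_commute vector_add_ldistrib
          add_ac)
    ultimately show ?thesis by (simp add: BQ0)
  qed
  have \<phi>_neg: "(\<Sum>j\<in>UNIV. \<phi> $ j * (B *v x) $ j) = - dG w" if "B *v x + A *v w = 0" for B x w
  proof -
    have "B *v x = - (A *v w)" using that by (simp add: eq_neg_iff_add_eq_0)
    then show ?thesis by (simp add: \<phi>_A[symmetric] sum_negf)
  qed
  have first: "(\<Sum>j\<in>UNIV. \<phi> $ j * (B *v P0) $ j) = 0" if B: "B \<in> frame_tangent S A" for B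
  proof -
    have "tangent_derivative A B (\<lambda>y. poly (chart_family G k l y) a) = 0"
      using stable(1) f0 f1 B by (auto simp: double_root_stable_def)
    moreover have "tangent_derivative A B (\<lambda>y. poly (chart_family G k l y) a) = dG (v B)"
      unfolding poly_f by (subst tangent_derivative_eval_at) (simp_all add: reg v P0_fun dG_def g_def)
    ultimately show ?thesis using \<phi>_neg[OF BP0] by simp
  qed
  \<comment> \<open>The Hessian of \<open>G\<close> at \<open>P0\<close>, paired with the direction
    \<open>Q0\<close> of the line.\<close>
  define H where "H x = (\<Sum>i\<in>UNIV. (\<Sum>j\<in>UNIV. eval_at (partial j (partial i G)) (($) P0) * x $ j) * Q0 $ i)" for x
  have H_add: "H (x + y) = H x + H y" and H_scale: "H (s *s x) = s * H x" for x y s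
    by (simp_all add: H_def distrib_left distrib_right sum.distrib sum_distrib_left mult_ac)
  have H_P0: "H P0 = 0"
  proof -
    define w where "w = (\<Sum>i\<in>UNIV. smult (Q0 $ i) (along (partial i G) (($) P0) (($) P0)))"
    \<comment> \<open>\<open>w\<close> is the derivative of \<open>G\<close> in direction
      \<open>Q0\<close> at \<open>(1 + t) P0\<close>. At \<open>t = -1\<close> this is the zero
      vector, which represents no point, so contact says nothing; the factor \<open>1 + t\<close>
      covers that value.\<close>
    have "poly ([:1, 1:] * w) t = 0" for t
    proof (cases "t = -1")
      case False
      then have "1 + t \<noteq> 0" by (metis add.commute eq_neg_iff_add_eq_0)
      from vanish(2)[OF this] have "poly w t = 0"
        by (simp add: w_def poly_sum poly_along algebra_simps)
      then show ?thesis by simp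
    qed simp
    then have "[:1, 1:] * w = 0" using poly_all_0_iff_0 by blast
    then have "([:1, 1:] :: complex poly) = 0 \<or> w = 0" by (simp only: mult_eq_0_iff)
    then have "w = 0" by simp
    then have "poly (pderiv w) 0 = 0" by simp
    moreover have "poly (pderiv w) 0 = H P0"
      by (simp add: w_def pderiv_sum pderiv_smult poly_sum poly_pderiv_along H_def mult.commute)
    ultimately show ?thesis by simp
  qed
  have second: "(\<Sum>j\<in>UNIV. \<phi> $ j * (B *v Q0) $ j) = 0"
    if B: "B \<in> frame_tangent S A" "B *v P0 = 0"
      and contact3: "\<And>p q. line_coords (line_of A) P p q \<Longrightarrow> [:0, 1:] ^ 3 dvd along G (($) p) (($) q)"
    for B
  proof -
    have H_Q0: "H Q0 = 0"
      using X_cube_dvd_imp[OF contact3[OF lc0]] by (simp add: poly_pderiv_pderiv_along H_def)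
    have "poly (pderiv (pderiv (chart_family G k l A))) a = 0"
      unfolding chart_family_def poly_pderiv_pderiv_along P0_fun
      unfolding Q0_def[symmetric] using H_Q0 by (simp add: H_def)
    then have "tangent_derivative A B (\<lambda>y. poly (pderiv (chart_family G k l y)) a) = 0"
      using stable(2) f1 B by (auto simp: double_root_stable_def)
    \<comment> \<open>Product rule: the direction of the line turns with velocity
      \<open>vq B\<close>, and the gradient of \<open>G\<close> changes with the velocity
      \<open>v B\<close> of the point.\<close>
    moreover have "tangent_derivative A B (\<lambda>y. poly (pderiv (chart_family G k l y)) a) = dG (vq B) + H (v B)"
    proof -
      have reg': "(\<lambda>y. eval_at (partial i G)
          (\<lambda>i. chart_vec k l None y $ i + a * chart_vec k l (Some None) y $ i)) \<in> regular_functions" for i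
        by (intro subalgebra_eval_at reg)
      have "tangent_derivative A B (\<lambda>y. poly (pderiv (chart_family G k l y)) a) =
        (\<Sum>i\<in>UNIV. g i * vq B $ i +
          (\<Sum>j\<in>UNIV. eval_at (partial j (partial i G)) (($) P0) * v B $ j) * Q0 $ i)"
        unfolding poly_f'
        by (simp add: tangent_derivative_sum tangent_derivative_mult reg reg'
            tangent_derivative_eval_at v P0_fun g_def vq_def Q0_def)
      then show ?thesis by (simp add: sum.distrib dG_def H_def)
    qed
    \<comment> \<open>As \<open>B\<close> annihilates \<open>P0\<close>, the velocity
      \<open>v B\<close> lies in the line, on which \<open>H\<close> is zero by the Euler relation
      and the triple contact.\<close>
    moreover have "H (v B) = 0"
    proof -
      have "A *v v B = 0" using BP0[of B] B(2) by simp
      then show ?thesis unfolding ker by (auto simp: H_add H_scale H_P0 H_Q0)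
    qed
    ultimately show ?thesis using \<phi>_neg[OF BQ0] by simp
  qed
  have \<phi>_lin: "(\<Sum>j\<in>UNIV. \<phi> $ j * (B *v (s *s P0 + t *s Q0)) $ j) =
      s * (\<Sum>j\<in>UNIV. \<phi> $ j * (B *v P0) $ j) + t * (\<Sum>j\<in>UNIV. \<phi> $ j * (B *v Q0) $ j)" for B s t
    by (simp add: matrix_vector_right_distrib vector_scalar_commute distrib_left sum.distrib
        sum_distrib_left mult_ac)
  have "q \<in> line_of A" using lc by (auto simp: line_coords_def intro: vec.span_base)
  then obtain s t where q: "q = s *s P0 + t *s Q0" unfolding line_of_def using ker by auto
  show ?thesis
  proof (intro exI[of _ \<phi>] conjI ballI impI)
    show "\<phi> \<noteq> 0" by fact
    fix B assume B: "B \<in> frame_tangent S A"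
    show "(\<Sum>i\<in>UNIV. \<phi> $ i * (B *v p) $ i) = 0"
      using \<phi>_lin[of B c 0] first[OF B] by (simp add: p)
    assume contact3: "\<forall>p q. line_coords (line_of A) P p q \<longrightarrow> [:0, 1:] ^ 3 dvd along G (($) p) (($) q)"
      and "B *v p = 0"
    then have "B *v P0 = 0" using c by (simp add: p vector_scalar_commute)
    from second[OF B this] contact3 first[OF B] show "(\<Sum>i\<in>UNIV. \<phi> $ i * (B *v q) $ i) = 0"
      unfolding q \<phi>_lin by simp
  qed
qed

section \<open>From one system of equations to all focal minors\<close>

definition focal_generic ::
    "('n::finite) hvec set set \<Rightarrow> 'n option option mpoly \<Rightarrow> 'n option option \<Rightarrow> 'n option option \<Rightarrow> 'n eqs \<Rightarrow> bool" where
  "focal_generic S G k l A \<longleftrightarrow> chart_det k l A \<noteq> 0 \<and> double_root_stable S (chart_family G k l) A \<and>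
     double_root_stable S (\<lambda>y. pderiv (chart_family G k l y)) A"

text \<open>\<open>focal_minors\<close> ranges over all equations \<open>A\<close> of the line,
  while genericity is known for the one system \<open>A0\<close>. The form found for
  \<open>A0\<close> is carried to \<open>A\<close> by the transition matrix, and then
  \<open>det_pencil\<close> applies.\<close>

lemma focal_minors_dvd:
  assumes generic: "focal_generic S G k l A0" and lc: "line_coords (line_of A0) P p q" and pk: "p $ k \<noteq> 0"
    and G: "homogeneous d G" "eval_at (partial i0 G) (($) p) \<noteq> 0"
    and contact: "\<And>p q. line_coords (line_of A0) P p q \<Longrightarrow> [:0, 1:] ^ 2 dvd along G (($) p) (($) q)"
    and g: "g \<in> focal_minors S (line_of A0) p q"
  shows "poly g 0 = 0"
    and "(\<And>p q. line_coords (line_of A0) P p q \<Longrightarrow> [:0, 1:] ^ 3 dvd along G (($) p) (($) q)) \<Longrightarrow>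
      [:0, 1:] ^ 2 dvd g"
proof -
  obtain A B where A: "line_of A = line_of A0" and B: "\<And>j. B j \<in> frame_tangent S A"
    and g_def: "g = det (\<chi> i j. [:(B j *v p) $ i, (B j *v q) $ i:])"
    using g unfolding focal_minors_def by blast
  have kl: "chart_det k l A0 \<noteq> 0" using generic by (simp add: focal_generic_def)
  then have "chart_det k l A \<noteq> 0"
    using A unfolding chart_det_nonzero_iff line_of_def by blast
  then obtain M M' where M: "M ** M' = mat 1" "M' ** M = mat 1" "A = M ** A0"
    using same_line_transition A by blast
  then have A0: "A0 = M' ** A" by (simp add: matrix_mul_assoc)
  have stable: "double_root_stable S (chart_family G k l) A0"
    "double_root_stable S (\<lambda>y. pderiv (chart_family G k l y)) A0"
    using generic by (simp_all add: focal_generic_def)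
  obtain \<phi>0 where *: "\<phi>0 \<noteq> 0 \<and>
    (\<forall>B\<in>frame_tangent S A0. (\<Sum>i\<in>UNIV. \<phi>0 $ i * (B *v p) $ i) = 0) \<and>
    ((\<forall>p q. line_coords (line_of A0) P p q \<longrightarrow> [:0, 1:] ^ 3 dvd along G (($) p) (($) q)) \<longrightarrow>
      (\<forall>B\<in>frame_tangent S A0. B *v p = 0 \<longrightarrow> (\<Sum>i\<in>UNIV. \<phi>0 $ i * (B *v q) $ i) = 0))"
    using focal_form[OF kl stable lc pk G contact] by (rule exE)
  then have \<phi>0: "\<phi>0 \<noteq> 0"
    "\<And>B. B \<in> frame_tangent S A0 \<Longrightarrow> (\<Sum>i\<in>UNIV. \<phi>0 $ i * (B *v p) $ i) = 0"
    by simp_all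
  have \<phi>0': "(\<Sum>i\<in>UNIV. \<phi>0 $ i * (B *v q) $ i) = 0"
    if "\<And>p q. line_coords (line_of A0) P p q \<Longrightarrow> [:0, 1:] ^ 3 dvd along G (($) p) (($) q)"
      "B \<in> frame_tangent S A0" "B *v p = 0" for B
    using * that by simp
  define \<phi> where "\<phi> = (\<chi> j. \<Sum>i\<in>UNIV. \<phi>0 $ i * M' $ i $ j)"
  have \<phi>: "(\<Sum>j\<in>UNIV. \<phi> $ j * x $ j) = (\<Sum>i\<in>UNIV. \<phi>0 $ i * (M' *v x) $ i)" for x
    unfolding \<phi>_def matrix_vector_mult_def vec_lambda_beta sum_distrib_left sum_distrib_right
    by (subst sum.swap) (simp add: mult.assoc)
  have "\<phi> \<noteq> 0"
  proof
    assume "\<phi> = 0"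
    then have "(\<Sum>i\<in>UNIV. \<phi>0 $ i * x $ i) = 0" for x
      using \<phi>[of "M *v x"] by (simp add: matrix_vector_mul_assoc M)
    from this[of "axis _ 1"] have "\<phi>0 $ i = 0" for i
      by (simp add: axis_def if_distrib[of "\<lambda>x. _ * x"] cong: if_cong)
    with \<phi>0(1) show False by (simp add: vec_eq_iff)
  qed
  have tangent: "M' ** C \<in> frame_tangent S A0" if "C \<in> frame_tangent S A" for C
    unfolding A0 by (rule frame_tangent_mult[OF M(1) that])
  have first: "(\<Sum>i\<in>UNIV. \<phi> $ i * (C *v p) $ i) = 0" if "C \<in> frame_tangent S A" for C
    using \<phi>0(2)[OF tangent[OF that]] by (simp add: \<phi> matrix_vector_mul_assoc)
  define M0 M1 where "M0 = (\<chi> i j. (B j *v p) $ i)" and "M1 = (\<chi> i j. (B j *v q) $ i)"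
  have M0: "(\<Sum>i\<in>UNIV. \<phi> $ i * M0 $ i $ j) = 0" for j
    using first[OF B[of j]] by (simp add: M0_def)
  have g': "g = det (\<chi> i j. [:M0 $ i $ j, M1 $ i $ j:])"
    by (simp add: g_def M0_def M1_def)
  show "poly g 0 = 0"
    unfolding g' by (rule det_pencil(1)[OF \<open>\<phi> \<noteq> 0\<close> M0])
  assume contact3: "\<And>p q. line_coords (line_of A0) P p q \<Longrightarrow> [:0, 1:] ^ 3 dvd along G (($) p) (($) q)"
  show "[:0, 1:] ^ 2 dvd g"
    unfolding g'
  proof (rule det_pencil(2)[OF \<open>\<phi> \<noteq> 0\<close> M0])
    fix \<psi> assume \<psi>: "M0 *v \<psi> = 0"
    define C where "C = (\<chi> r s. \<Sum>j\<in>UNIV. \<psi> $ j * B j $ r $ s)"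
    have C: "C \<in> frame_tangent S A"
      unfolding C_def by (rule frame_tangent_combination[OF B])
    have Cx: "C *v x = (\<chi> i j. (B j *v x) $ i) *v \<psi>" for x
      unfolding C_def matrix_vector_mult_def vec_eq_iff vec_lambda_beta sum_distrib_left sum_distrib_right
      by (subst sum.swap) (simp add: mult_ac)
    have "M' ** C *v p = 0"
      using \<psi> by (simp add: Cx M0_def flip: matrix_vector_mul_assoc)
    from \<phi>0'[OF contact3 tangent[OF C] this]
    show "(\<Sum>i\<in>UNIV. \<phi> $ i * (M1 *v \<psi>) $ i) = 0"
      by (simp add: \<phi> M1_def flip: Cx matrix_vector_mul_assoc)
  qed
qed

text \<open>Each condition holds generically by itself, and irreducibility allows finitely many of
  them to be combined. Both orders of \<open>k\<close> and \<open>l\<close> are demanded so that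
  every point of the line is at finite distance in one of the two charts.\<close>

lemma focal_generic_on_nonempty_open:
  assumes S: "S \<subseteq> lines" "irreducible_space (subtopology grass_zariski S)"
  shows "\<exists>r k l. r \<in> regular_functions \<and> (\<exists>A\<in>frames S. r A \<noteq> 0) \<and>
    (\<forall>A\<in>frames S. r A \<noteq> 0 \<longrightarrow> focal_generic S G k l A \<and> focal_generic S G l k A)"
proof -
  define D where "D P \<longleftrightarrow> (\<exists>r\<in>regular_functions. (\<exists>A\<in>frames S. r A \<noteq> 0) \<and>
    (\<forall>A\<in>frames S. r A \<noteq> 0 \<longrightarrow> P A))" for P
  have D_conj: "D (\<lambda>A. P A \<and> P' A)" if "D P" "D P'" for P P'
  proof -
    obtain r where "r \<in> regular_functions"
      "(\<exists>A\<in>frames S. r A \<noteq> 0) \<and> (\<forall>A\<in>frames S. r A \<noteq> 0 \<longrightarrow> P A)"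
      using \<open>D P\<close> unfolding D_def by (rule bexE)
    moreover obtain s where "s \<in> regular_functions"
      "(\<exists>A\<in>frames S. s A \<noteq> 0) \<and> (\<forall>A\<in>frames S. s A \<noteq> 0 \<longrightarrow> P' A)"
      using \<open>D P'\<close> unfolding D_def by (rule bexE)
    ultimately show ?thesis
      unfolding D_def using frames_irreducible[OF S, of r s] subalgebra_mult[OF subalgebra_regular, of r s]
      by (intro bexI[of _ "\<lambda>A. r A * s A"]) auto
  qed
  obtain L where "L \<in> S" "L \<in> topspace grass_zariski"
    using S(2) by (auto simp: irreducible_space_def)
  then obtain A0 where A0: "A0 \<in> frames S" "line_of A0 \<in> lines"
    by (auto simp: grass_zariski_def frames_def)
  then obtain k l where kl: "chart_det k l A0 \<noteq> 0" using chart_exists by blast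
  then have lk: "chart_det l k A0 \<noteq> 0" by (auto simp: chart_det_nonzero_iff)
  have chart: "D (\<lambda>A. chart_det k l A \<noteq> 0)" if "chart_det k l A0 \<noteq> 0" for k l
    unfolding D_def using that A0 by (intro bexI[OF _ chart_det_regular]) auto
  have stable: "D (double_root_stable S f)" if "poly_family regular_functions f" for f
    unfolding D_def using A0(1) by (intro double_root_stable_generic that) auto
  note fam = poly_family_chart poly_family_pderiv[OF subalgebra_regular poly_family_chart]
  have focal: "D (focal_generic S G k l)" if "chart_det k l A0 \<noteq> 0" for k l
    unfolding focal_generic_def[abs_def] by (intro D_conj chart stable fam that)
  then have "D (\<lambda>A. focal_generic S G k l A \<and> focal_generic S G l k A)"
    by (intro D_conj focal kl lk)
  then show ?thesis unfolding D_def by blast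
qed

section \<open>The hypersurface\<close>

lemma nonempty_open_dense:
  assumes "irreducible_space T" "openin T U" "U \<noteq> {}"
  shows "dense_open_in T U"
proof -
  have "x \<in> T closure_of U" if "x \<in> topspace T" for x
    unfolding in_closure_of
  proof (intro conjI allI impI)
    fix V assume "x \<in> V \<and> openin T V"
    then have "U \<inter> V \<noteq> {}" using assms unfolding irreducible_space_def by blast
    then show "\<exists>y. y \<in> U \<and> y \<in> V" by blast
  qed (rule that)
  then show ?thesis
    using assms(2) by (auto simp: dense_open_in_def closure_of_subset_topspace[THEN subsetD])
qed

lemma eval_at_homogeneous_0: "homogeneous 0 F \<Longrightarrow> eval_at F x = eval_at F y"
  using eval_at_homogeneous[of 0 F 0 x] eval_at_homogeneous[of 0 F 0 y] by simp

lemma eval_at_homogeneous_0_nonzero: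
  assumes "homogeneous 0 F" "F \<noteq> 0"
  shows "eval_at F x \<noteq> 0"
proof -
  have "m = 0" if "m \<in> Poly_Mapping.keys F" for m
    using assms(1) that by (intro poly_mapping_eqI) (auto simp: homogeneous_def)
  then have "Poly_Mapping.keys F \<subseteq> {0}" by blast
  moreover from this have "0 \<in> Poly_Mapping.keys F"
    using assms(2) by (metis keys_eq_empty singletonI subset_singletonD)
  ultimately show ?thesis
    using eval_at_superset[of "{0}" F x] by (simp add: in_keys_iff)
qed

text \<open>A form of least degree in the ideal cannot have all its partial derivatives in the ideal.\<close>

lemma smooth_form_exists:
  assumes X: "hypersurface X" "X \<noteq> {}"
  shows "\<exists>G d i. G \<in> hom_ideal X \<and> homogeneous d G \<and> (\<exists>P\<in>X. \<not> vanishes_at (partial i G) P)"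
proof -
  obtain F d where F: "F \<noteq> 0" "homogeneous d F" "X = zero_set F"
    using X(1) by (auto simp: hypersurface_def)
  define I where "I d \<longleftrightarrow> (\<exists>G. G \<noteq> 0 \<and> homogeneous d G \<and> (\<forall>P\<in>X. vanishes_at G P))" for d
  have "I d" using F by (auto simp: I_def zero_set_def)
  define e where "e = (LEAST d. I d)"
  have "I e" unfolding e_def using \<open>I d\<close> by (rule LeastI)
  then obtain G where G: "G \<noteq> 0" "homogeneous e G" "\<And>P. P \<in> X \<Longrightarrow> vanishes_at G P"
    by (auto simp: I_def)
  have "e \<noteq> 0"
  proof
    assume "e = 0"
    obtain P where P: "P \<in> X" using X(2) by blast
    then have "vec.subspace P" using F(3) by (auto simp: zero_set_def points_def)
    then have "0 \<in> P" by (rule vec.subspace_0)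
    with G(3)[OF P] have "eval_at G (($) 0) = 0" by (auto simp: vanishes_at_def)
    with eval_at_homogeneous_0_nonzero[of G "($) 0"] G \<open>e = 0\<close> show False by auto
  qed
  have "\<exists>i. \<exists>P\<in>X. \<not> vanishes_at (partial i G) P"
  proof (rule ccontr)
    assume "\<not> ?thesis"
    then have *: "\<And>i P. P \<in> X \<Longrightarrow> vanishes_at (partial i G) P" by blast
    have "partial i G = 0" for i
    proof (rule ccontr)
      assume "partial i G \<noteq> 0"
      then have "I (e - 1)" using * homogeneous_partial[OF G(2)] by (auto simp: I_def)
      then have "e \<le> e - 1" by (simp add: e_def Least_le)
      with \<open>e \<noteq> 0\<close> show False by simp
    qed
    then have "homogeneous 0 G" by (rule homogeneous_0_if_partial_zero)
    moreover obtain m where "m \<in> Poly_Mapping.keys G"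
      using G(1) by (metis ex_in_conv keys_eq_empty)
    ultimately show False using G(2) \<open>e \<noteq> 0\<close> by (auto simp: homogeneous_def)
  qed
  with G show ?thesis unfolding hom_ideal_def by blast
qed

text \<open>\<open>proj_zariski\<close> is generated by forms of positive degree, so constants are
  treated apart. They do occur, as partial derivatives of a linear form when \<open>X\<close> is a
  hyperplane.\<close>

lemma openin_nonvanishing:
  assumes "homogeneous d F"
  shows "openin (subtopology proj_zariski X) {P \<in> topspace (subtopology proj_zariski X). \<not> vanishes_at F P}"
proof (cases "d = 0")
  case False
  have "{P \<in> topspace (subtopology proj_zariski X). \<not> vanishes_at F P} = (points - zero_set F) \<inter> X"
  proof -
    have "points - zero_set F \<subseteq> topspace proj_zariski"
      unfolding proj_zariski_def using assms False by auto
    moreover have "topspace proj_zariski \<subseteq> points" by (auto simp: proj_zariski_def)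
    ultimately show ?thesis by (auto simp: zero_set_def)
  qed
  moreover have "openin proj_zariski (points - zero_set F)"
    unfolding proj_zariski_def using assms False by (intro topology_generated_by_Basis) auto
  ultimately show ?thesis by (simp add: openin_subtopology_Int)
next
  case True
  define c where "c = eval_at F (\<lambda>i. 0)"
  have c: "eval_at F x = c" for x
    unfolding c_def using eval_at_homogeneous_0 assms True by blast
  have "vanishes_at F P \<longleftrightarrow> c = 0" if "P \<in> topspace (subtopology proj_zariski X)" for P
  proof -
    have "vec.subspace P" using that by (auto simp: proj_zariski_def points_def)
    then have "0 \<in> P" by (rule vec.subspace_0)
    then show ?thesis by (auto simp: vanishes_at_def c)
  qed
  then have "{P \<in> topspace (subtopology proj_zariski X). \<not> vanishes_at F P} =
      (if c = 0 then {} else topspace (subtopology proj_zariski X))"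
    by auto
  then show ?thesis by (cases "c = 0") (simp_all only: if_True if_False openin_empty openin_topspace simp_thms)
qed

lemma vanishes_at_span:
  assumes "homogeneous d F"
  shows "vanishes_at F (vec.span {p}) \<longleftrightarrow> eval_at F (($) p) = 0"
proof -
  have "eval_at F (($) (c *s p)) = c ^ d * eval_at F (($) p)" for c
  proof -
    have "($) (c *s p) = (\<lambda>i. c * p $ i)" by auto
    then show ?thesis using eval_at_homogeneous[OF assms] by simp
  qed
  moreover have "p \<in> vec.span {p}" by (simp add: vec.span_base)
  ultimately show ?thesis by (auto simp: vanishes_at_def vec.span_singleton)
qed

lemma intersection_mult_dvd:
  assumes "G \<in> hom_ideal X" "line_coords L P p q" "m \<le> intersection_mult X L P"
  shows "[:0, 1:] ^ m dvd along G (($) p) (($) q)"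
proof (cases "along G (($) p) (($) q) = 0")
  case False
  have "intersection_mult X L P \<le> order 0 (along G (($) p) (($) q))"
    unfolding intersection_mult_def using assms(1,2) False by (intro Least_le) blast
  with assms(3) have "m \<le> order 0 (along G (($) p) (($) q))" by (rule le_trans)
  then show ?thesis using order_divides[of 0 m "along G (($) p) (($) q)"] by simp
qed simp

theorem lemma3p7:
  fixes S X U :: "('n::finite) hvec set set"
  assumes "filling_family S"
    and "hypersurface X"
    and "irreducible_space (subtopology proj_zariski X)"
    and "dense_open_in (subtopology grass_zariski S) U"
    and "\<forall>L\<in>U. \<exists>P. tangent_at X L P"
    and "X \<subseteq> proj_zariski closure_of {P. \<exists>L\<in>U. tangent_at X L P}"
  shows "\<exists>V W. dense_open_in (subtopology grass_zariski S) V \<and>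
           dense_open_in (subtopology proj_zariski X) W \<and>
           (\<forall>L\<in>V. \<forall>P\<in>W. tangent_at X L P \<longrightarrow>
              is_focus S L P \<and>
              (contact_order X L P \<ge> 2 \<longrightarrow> focus_of_mult_ge 2 S L P))"
proof -
  have S: "S \<subseteq> lines" "irreducible_space (subtopology grass_zariski S)"
    using assms(1) by (auto simp: filling_family_def family_of_lines_def)
  have X: "X \<subseteq> points" "X \<noteq> {}"
    using assms(2,3) by (auto simp: hypersurface_def zero_set_def irreducible_space_def)
  obtain G d i where G: "G \<in> hom_ideal X" "homogeneous d G" "\<exists>P\<in>X. \<not> vanishes_at (partial i G) P"
    using smooth_form_exists[OF assms(2) X(2)] by blast
  obtain r k l where r: "r \<in> regular_functions" "\<exists>A\<in>frames S. r A \<noteq> 0"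
    and generic: "\<And>A. A \<in> frames S \<Longrightarrow> r A \<noteq> 0 \<Longrightarrow> focal_generic S G k l A \<and> focal_generic S G l k A"
    using focal_generic_on_nonempty_open[OF S, of G] by blast
  define V where "V = {line_of A | A. line_of A \<in> lines \<and> r A \<noteq> 0} \<inter> S"
  \<comment> \<open>At the points of \<open>W\<close> the gradient of \<open>G\<close> is nonzero;
    this makes the form \<open>\<phi>\<close> of \<open>focal_form\<close> nonzero.\<close>
  define W where "W = {P \<in> topspace (subtopology proj_zariski X). \<not> vanishes_at (partial i G) P}"
  have "V \<noteq> {}" using r(2) S(1) by (auto simp: V_def frames_def)
  then have V: "dense_open_in (subtopology grass_zariski S) V"
    unfolding V_def by (intro nonempty_open_dense S openin_subtopology_Int openin_grass r)
  have "X \<subseteq> topspace proj_zariski"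
    using assms(6) closure_of_subset_topspace by (rule order_trans)
  then have "W \<noteq> {}" using G(3) by (auto simp: W_def)
  then have W: "dense_open_in (subtopology proj_zariski X) W"
    unfolding W_def by (intro nonempty_open_dense assms openin_nonvanishing[OF homogeneous_partial[OF G(2)]])
  have focal: "poly g 0 = 0 \<and> (contact_order X L P \<ge> 2 \<longrightarrow> [:0, 1:] ^ 2 dvd g)"
    if L: "L \<in> V" and P: "P \<in> W" and tangent: "tangent_at X L P" and lc: "line_coords L P p q"
      and g: "g \<in> focal_minors S L p q" for L P p q g
  proof -
    obtain A where A: "L = line_of A" "A \<in> frames S" "r A \<noteq> 0"
      using L by (auto simp: V_def frames_def)
    \<comment> \<open>\<open>contact_order\<close> is \<open>intersection_mult\<close> minus one, so
      contact order 1 gives a square here, and contact order 2 a cube in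
      \<open>contact3\<close>.\<close>
    have contact: "[:0, 1:] ^ 2 dvd along G (($) p) (($) q)"
      if "line_coords (line_of A) P p q" for p q
      using tangent that A(1)
      by (intro intersection_mult_dvd[OF G(1)]) (auto simp: tangent_at_def contact_order_def)
    have contact3: "[:0, 1:] ^ 3 dvd along G (($) p) (($) q)"
      if "line_coords (line_of A) P p q" "contact_order X L P \<ge> 2" for p q
      using that A(1)
      by (intro intersection_mult_dvd[OF G(1)]) (auto simp: contact_order_def)
    have "P = vec.span {p}" using lc by (simp add: line_coords_def)
    with P have smooth: "eval_at (partial i G) (($) p) \<noteq> 0"
      by (simp add: W_def vanishes_at_span[OF homogeneous_partial[OF G(2)]])
    have "p \<noteq> 0"
    proof
      assume "p = 0"
      with \<open>P = vec.span {p}\<close> have "vec.dim P = 0" by simp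
      moreover have "vec.dim P = 1" using P X(1) by (auto simp: W_def points_def)
      ultimately show False by linarith
    qed
    moreover have "A *v p = 0"
      using lc A(1) vec.span_base[of p "{p, q}"] by (auto simp: line_coords_def line_of_def)
    moreover have "chart_det k l A \<noteq> 0" using generic A by (auto simp: focal_generic_def)
    \<comment> \<open>A nonzero vector of the line cannot have both chart coordinates zero, so the
      order of \<open>k\<close> and \<open>l\<close> can be chosen such that \<open>P\<close> is not
      at infinity.\<close>
    ultimately have "p $ k \<noteq> 0 \<or> p $ l \<noteq> 0" unfolding chart_det_nonzero_iff by blast
    then obtain k' l' where kl: "focal_generic S G k' l' A" "p $ k' \<noteq> 0"
      using generic A by blast
    note minors = focal_minors_dvd[OF kl(1) lc[unfolded A(1)] kl(2) G(2) smooth _ g[unfolded A(1)]]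
    have "poly g 0 = 0" by (rule minors(1)) (rule contact)
    moreover have "[:0, 1:] ^ 2 dvd g" if "contact_order X L P \<ge> 2"
      by (rule minors(2)) (rule contact contact3 that, assumption?)+
    ultimately show ?thesis by blast
  qed
  have "is_focus S L P \<and> (contact_order X L P \<ge> 2 \<longrightarrow> focus_of_mult_ge 2 S L P)"
    if "L \<in> V" "P \<in> W" "tangent_at X L P" for L P
    using focal[OF that] that X(1)
    unfolding is_focus_def focus_of_mult_ge_def V_def W_def tangent_at_def by auto
  with V W show ?thesis by blast
qed

end
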